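(* Let $q$ be a complex number with $0<|q|<1$ and let $s,r$ be integers with $0\le s<r$. Let $\mathbf a=(a_1,\dots,a_r)\in\mathbb C^r$ satisfy $a_i-a_j\notin\mathbb Z$ for $1\le i<j\le r$, let $\mathbf b=(b_1,\dots,b_s)\in\mathbb C^s$ be arbitrary, and let $\mathbf m=(m_1,\dots,m_s)\in\mathbb Z^s$, $\mathbf n=(n_1,\dots,n_r)\in\mathbb Z^r$, $t\in\mathbb Z$. Put $$M=\sum_{i=1}^s m_i,\quad N=\sum_{i=1}^r n_i,\quad m_{\min}=\min_{1\le i\le s}m_i,\quad n_{\max}=\max_{1\le i\le r}n_i,$$ $$p'=\left[\frac{M-N-r-t+1}{r-s}\right],\quad K=\max(-m_{\min}-1,\,p')+(t)_+,\quad W=q^{t+r-1}\prod_{i=1}^r q^{a_i}\prod_{i=1}^s q^{-b_i},$$ where $[x]$ is the integer part (floor) of $x$. For integers $k\ge -n_{\max}$ define $$\beta_k=\sum_{j=\max(-n_{\max},\,k-(t)_+)}^{k}\begin{bmatrix}(t)_+\\ k-j\end{bmatrix}_q q^{(k-j)(k-j-1)/2}(-1)^{k-j}\sum_{i=1}^r\frac{q^{a_i(1-t)}\prod_{l=1}^s(q^{1-b_l+a_i};q)_{m_l+j}}{(q;q)_{j+n_i}\prod_{l\ne i}(q^{a_i-a_l};q)_{n_l+j+1}}$$ $$\times\;{}_{r+s}\phi_{r+s-1}\left(\begin{array}{c}q^{-j-n_i},\ (q^{b_l-a_i})_{1\le l\le s},\ (q^{a_l-a_i-n_l-j})_{l\ne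 i}\\ (q^{b_l-a_i-m_l-j})_{1\le l\le s},\ (q^{1-a_i+a_l})_{l\ne i}\end{array}\Big|\ q^{N-M+r-1+t+j(r-s)}\right),$$ where every term with $j+n_i<0$ is taken to be $0$. Then $$\sum_{i=1}^r q^{a_i(1-t)}\frac{\prod_{l=1}^s(q^{1-b_l+a_i};q)_\infty}{\prod_{l\ne i}(q^{a_i-a_l};q)_\infty}\;{}_s\phi_{r-1}\left(\begin{array}{c}(q^{b_l-a_i})_{1\le l\le s}\\ (q^{1+a_l-a_i})_{l\ne i}\end{array}\Big|\ Wq^{(s-r)a_i}\right)=(q^t;q)_\infty\sum_{k=-n_{\max}}^{K}\beta_k .$$ (Since $(q^t;q)_\infty=0$ for $t\le0$, the right-hand side vanishes for such $t$.)
   Context: A logarithm of $q$ is fixed and $q^x=\exp(x\log q)$ for $x\in\mathbb C$. For $n\ge 1$ the $q$-shifted factorial is $(a;q)_0=1$, $(a;q)_n=\prod_{k=0}^{n-1}(1-aq^k)$, $(a;q)_{-n}=\prod_{k=1}^{n}\frac{1}{1-aq^{-k}}$, and $(a;q)_\infty=\lim_{n\to\infty}(a;q)_n$. In particular $1/(q;q)_{-n}=0$ for $n\ge1$. The basic hypergeometric function (base $q$ suppressed) is $${}_r\phi_{s}\left(\begin{array}{c}c_1,\dots,c_r\\ d_1,\dots,d_s\end{array}\Big|\ z\right)=\sum_{n=0}^\infty\frac{(c_1;q)_n\cdots(c_r;q)_n}{(d_1;q)_n\cdots(d_s;q)_n(q;q)_n}\left[(-1)^nq^{n(n-1)/2}\right]^{1+s-r}z^n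 ,\qquad r\le s+1;$$ it converges for all $z$ if $r\le s$ and for $|z|<1$ if $r=s+1$, and it terminates (so is defined for all $z$) if some upper parameter is $q^{-L}$ with $L\in\{0,1,2,\dots\}$. $\begin{bmatrix}n\\ j\end{bmatrix}_q=\frac{(q;q)_n}{(q;q)_j(q;q)_{n-j}}$ is the $q$-binomial coefficient (zero for $j>n$ or $j<0$), and $(x)_+=\max(0,x)$. Empty sums are $0$, empty products are $1$; for $s=0$ one takes $m_{\min}=+\infty$, i.e. $K=p'+(t)_+$. "$l\neq i$" means $1\le l\le r$, $l\ne i$. The identity is understood for parameter values for which all expressions occurring in it are defined (no vanishing denominators). *)

theory Defs
  imports "HOL-Analysis.Analysis"
begin

text \<open>
  Throughout, \<open>lq\<close> is the fixed logarithm of \<open>q\<close>; every power of \<open>q\<close> with a complex exponent is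
  taken with respect to it.
\<close>

definition qpow :: "complex \<Rightarrow> complex \<Rightarrow> complex" where
  "qpow lq x = exp (x * lq)"

definition qpoch :: "complex \<Rightarrow> complex \<Rightarrow> int \<Rightarrow> complex" where
  "qpoch q a n =
     (if n \<ge> 0 then (\<Prod>k<nat n. 1 - a * q ^ k)
      else (\<Prod>k=1..nat (- n). 1 / (1 - a * q powi (- int k))))"

text \<open>
  For negative \<open>n\<close> the symbol is an honest value only if no factor in the denominator vanishes.
\<close>

definition qpoch_defined :: "complex \<Rightarrow> complex \<Rightarrow> int \<Rightarrow> bool" where
  "qpoch_defined q a n \<longleftrightarrow> (\<forall>k\<in>{1..nat (- n)}. 1 - a * q powi (- int k) \<noteq> 0)"

definition qpoch_inf :: "complex \<Rightarrow> complex \<Rightarrow> complex" where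
  "qpoch_inf q a = lim (\<lambda>n. qpoch q a (int n))"

definition qbinom :: "complex \<Rightarrow> int \<Rightarrow> int \<Rightarrow> complex" where
  "qbinom q n j =
     (if 0 \<le> j \<and> j \<le> n then qpoch q q n / (qpoch q q j * qpoch q q (n - j)) else 0)"

text \<open>
  The basic hypergeometric series with upper parameters \<open>cs\<close> and lower parameters \<open>ds\<close>. If an
  upper parameter is \<open>q\<^sup>-\<^sup>L\<close>, all summands with \<open>n > L\<close> are zero (also when a lower parameter
  makes the denominator vanish there, as division by zero gives zero), so that the value is the
  finite sum over \<open>n \<le> L\<close>, for every \<open>z\<close>.
\<close>

definition qhyper :: "complex \<Rightarrow> complex list \<Rightarrow> complex list \<Rightarrow> complex \<Rightarrow> complex" where
  "qhyper q cs ds z =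
     (\<Sum>n. (\<Prod>c\<leftarrow>cs. qpoch q c (int n)) / ((\<Prod>d\<leftarrow>ds. qpoch q d (int n)) * qpoch q q (int n))
          * ((-1) ^ n * q ^ (n * (n - 1) div 2)) powi (1 + int (length ds) - int (length cs))
          * z ^ n)"

text \<open>
  The vectors \<open>\<a>, \<n>\<close> are indexed by \<open>{1..r}\<close> and \<open>\<b>, \<m>\<close> by \<open>{1..s}\<close>. The list of indices
  \<open>l \<noteq> i\<close>:
\<close>

definition others :: "nat \<Rightarrow> nat \<Rightarrow> nat list" where
  "others r i = filter (\<lambda>l. l \<noteq> i) [1..<Suc r]"

definition n_max :: "nat \<Rightarrow> (nat \<Rightarrow> int) \<Rightarrow> int" where
  "n_max r n = Max (n ` {1..r})"

definition p_bound :: "nat \<Rightarrow> nat \<Rightarrow> (nat \<Rightarrow> int) \<Rightarrow> (nat \<Rightarrow> int) \<Rightarrow> int \<Rightarrow> int" where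
  "p_bound r s m n t =
     \<lfloor>real_of_int ((\<Sum>i=1..s. m i) - (\<Sum>i=1..r. n i) - int r - t + 1) / (real r - real s)\<rfloor>"

text \<open>For \<open>s = 0\<close> the minimum of the \<open>m\<^sub>i\<close> is \<open>+\<infinity>\<close>.\<close>

definition K_bound :: "nat \<Rightarrow> nat \<Rightarrow> (nat \<Rightarrow> int) \<Rightarrow> (nat \<Rightarrow> int) \<Rightarrow> int \<Rightarrow> int" where
  "K_bound r s m n t =
     (if s = 0 then p_bound r s m n t
      else max (- Min (m ` {1..s}) - 1) (p_bound r s m n t)) + max 0 t"

definition beta_term ::
  "complex \<Rightarrow> complex \<Rightarrow> nat \<Rightarrow> nat \<Rightarrow> (nat \<Rightarrow> complex) \<Rightarrow> (nat \<Rightarrow> complex) \<Rightarrow>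
   (nat \<Rightarrow> int) \<Rightarrow> (nat \<Rightarrow> int) \<Rightarrow> int \<Rightarrow> int \<Rightarrow> nat \<Rightarrow> complex" where
  "beta_term q lq r s a b m n t j i =
     (if j + n i < 0 then 0
      else
        qpow lq (a i * (1 - of_int t)) * (\<Prod>l=1..s. qpoch q (qpow lq (1 - b l + a i)) (m l + j))
        / (qpoch q q (j + n i)
           * (\<Prod>l\<in>{1..r} - {i}. qpoch q (qpow lq (a i - a l)) (n l + j + 1)))
        * qhyper q
            (qpow lq (of_int (- j - n i))
              # map (\<lambda>l. qpow lq (b l - a i)) [1..<Suc s]
              @ map (\<lambda>l. qpow lq (a l - a i - of_int (n l + j))) (others r i))
            (map (\<lambda>l. qpow lq (b l - a i - of_int (m l + j))) [1..<Suc s]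
              @ map (\<lambda>l. qpow lq (1 - a i + a l)) (others r i))
            (q powi ((\<Sum>l=1..r. n l) - (\<Sum>l=1..s. m l) + int r - 1 + t + j * (int r - int s))))"

definition beta ::
  "complex \<Rightarrow> complex \<Rightarrow> nat \<Rightarrow> nat \<Rightarrow> (nat \<Rightarrow> complex) \<Rightarrow> (nat \<Rightarrow> complex) \<Rightarrow>
   (nat \<Rightarrow> int) \<Rightarrow> (nat \<Rightarrow> int) \<Rightarrow> int \<Rightarrow> int \<Rightarrow> complex" where
  "beta q lq r s a b m n t k =
     (\<Sum>j = max (- n_max r n) (k - max 0 t)..k.
        qbinom q (max 0 t) (k - j) * q powi ((k - j) * (k - j - 1) div 2) * (-1) powi (k - j)
        * (\<Sum>i=1..r. beta_term q lq r s a b m n t j i))"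

definition W_arg ::
  "complex \<Rightarrow> complex \<Rightarrow> nat \<Rightarrow> nat \<Rightarrow> (nat \<Rightarrow> complex) \<Rightarrow> (nat \<Rightarrow> complex) \<Rightarrow> int \<Rightarrow> complex" where
  "W_arg q lq r s a b t =
     q powi (t + int r - 1) * (\<Prod>i=1..r. qpow lq (a i)) * (\<Prod>i=1..s. qpow lq (- b i))"

end

theory Submission
  imports Defs "HOL-Computational_Algebra.Polynomial_FPS"
begin

text \<open>
  Write \<open>A\<^sub>i\<close> and \<open>B\<^sub>l\<close> for the powers of \<open>q\<close> with exponents \<open>a\<^sub>i\<close> and \<open>b\<^sub>l\<close>, and let \<open>P(x)\<close> be the
  quotient of \<open>\<Prod>\<^sub>l (q x / B\<^sub>l; q)\<^sub>\<infinity>\<close> by \<open>\<Prod>\<^sub>i (x / A\<^sub>i; q)\<^sub>\<infinity>\<close>. Both sides of the identity are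
  \<open>(q; q)\<^sub>\<infinity>\<close> times the coefficient of \<open>x\<^sup>t\<^sup>-\<^sup>1\<close> in the Taylor series of \<open>P\<close> (and \<open>0\<close> if \<open>t \<le> 0\<close>).

  The common source is a residue computation for the rational functions
  \<open>F\<^sub>j(x) = x\<^sup>-\<^sup>t \<Prod>\<^sub>l (q x / B\<^sub>l; q) / \<Prod>\<^sub>i (x / A\<^sub>i; q)\<close> with the finite indices \<open>m\<^sub>l + j\<close> in the
  numerator and \<open>n\<^sub>i + j + 1\<close> in the denominator. Their poles outside the origin are the points
  \<open>A\<^sub>i q\<^sup>-\<^sup>k\<close> with \<open>0 \<le> k \<le> j + n\<^sub>i\<close> as soon as all \<open>m\<^sub>l + j \<ge> 0\<close>, and there is no residue at
  infinity as soon as \<open>j\<close> exceeds \<open>p'\<close>. Then the residues at these poles add up to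
  minus the residue at the origin (\<open>sum_pole_terms\<close>). Since rational functions suffice, the residue
  theorem is Lagrange interpolation (\<open>lagrange_leading_coeff\<close>,
  \<open>sum_over_poles_eq_coefficient\<close>). The functional equation of \<open>(x; q)\<^sub>\<infinity>\<close> shows that
  \<open>x\<^sup>t F\<^sub>j(x) = P(x) Q(q\<^sup>j x)\<close> with a power series \<open>Q\<close>, \<open>Q(0) = 1\<close>, independent of \<open>j\<close>.

  Left-hand side: for \<open>m = n = 0\<close> and \<open>j \<rightarrow> \<infinity>\<close> the residues converge to the terms of the
  nonterminating series divided by \<open>(q; q)\<^sub>\<infinity>\<close>, up to a common sign, the coefficient of \<open>P(x) Q(q\<^sup>j x)\<close> converges to
  that of \<open>P\<close>, and Tannery's theorem interchanges limit and sum (\<open>sum_qhyper_eq_coefficient\<close>).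

  Right-hand side: the inner sum \<open>\<gamma>\<^sub>j\<close> in the definition of \<open>\<beta>\<^sub>k\<close> is the sum of the residues at
  these poles written as terminating series (\<open>beta_term_eq_sum_pole_terms\<close>), up to the same sign.
  Hence for large \<open>j\<close> it is a polynomial in \<open>q\<^sup>j\<close> of degree at most \<open>t - 1\<close>, whose constant term
  is the wanted coefficient of \<open>P\<close>. The weights in \<open>\<beta>\<^sub>k\<close> are the coefficients of
  \<open>(y; q)\<^sub>t = (1 - y) (q y; q)\<^sub>t\<^sub>-\<^sub>1\<close>: the factor \<open>1 - y\<close> makes the sum over \<open>k\<close> telescope to
  its value at the upper end \<open>K\<close> (\<open>sum_signed_qbinom_convolution\<close>), where only the polynomial
  range of \<open>j\<close> enters, and \<open>(q y; q)\<^sub>t\<^sub>-\<^sub>1\<close> annihilates all its powers of \<open>q\<^sup>j\<close> except the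
  constant one, which it multiplies by \<open>(q; q)\<^sub>t\<^sub>-\<^sub>1\<close>. Finally \<open>(q\<^sup>t; q)\<^sub>\<infinity> (q; q)\<^sub>t\<^sub>-\<^sub>1 = (q; q)\<^sub>\<infinity>\<close>.
\<close>

section \<open>Residues of a rational function by Lagrange interpolation\<close>

text \<open>
  Up to sign, both sides are the leading coefficient of the Lagrange interpolation polynomial of
  \<open>R\<close> at the nodes \<open>Z\<close>: the basis polynomial at \<open>z\<close> is a product of factors \<open>1 - x / w\<close>, whose leading
  coefficient is the product of all \<open>-1 / w\<close> up to the factor \<open>-z\<close>. The coefficient is taken at
  index \<open>card Z - 1\<close>, so it is \<open>0\<close> when \<open>R\<close> has smaller degree.
\<close>

lemma lagrange_leading_coeff:
  fixes R :: "complex poly"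
  assumes fin: "finite Z" and nz: "0 \<notin> Z" and deg: "degree R < card Z"
  shows "(\<Sum>z\<in>Z. z * poly R z / (\<Prod>w\<in>Z - {z}. 1 - z / w)) * (\<Prod>w\<in>Z. - 1 / w)
         = - coeff R (card Z - 1)"
proof -
  define c where "c z = poly R z / (\<Prod>w\<in>Z - {z}. 1 - z / w)" for z
  define B where "B z = (\<Prod>w\<in>Z - {z}. [:1, - 1 / w:])" for z :: complex
  define L where "L = (\<Sum>z\<in>Z. smult (c z) (B z))"
  have wnz: "w \<noteq> 0" if "w \<in> Z" for w using that nz by auto
  have degB: "degree (B z) = card Z - 1" if "z \<in> Z" for z
  proof -
    have "degree (B z) = (\<Sum>w\<in>Z - {z}. degree [:1, - 1 / w:])"
      unfolding B_def by (rule degree_prod_sum_eq) (auto simp: wnz)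
    also have "\<dots> = (\<Sum>w\<in>Z - {z}. 1)" by (intro sum.cong) (auto simp: wnz)
    finally show ?thesis using that fin by simp
  qed
  have lcB: "coeff (B z) (card Z - 1) = (\<Prod>w\<in>Z - {z}. - 1 / w)" if "z \<in> Z" for z
  proof -
    have "coeff (B z) (card Z - 1) = lead_coeff (B z)" using degB[OF that] by simp
    also have "\<dots> = (\<Prod>w\<in>Z - {z}. lead_coeff [:1, - 1 / w:])"
      unfolding B_def by (rule lead_coeff_prod)
    also have "\<dots> = (\<Prod>w\<in>Z - {z}. - 1 / w)" by (intro prod.cong) (auto simp: wnz)
    finally show ?thesis .
  qed
  have polyB: "poly (B z) x = (\<Prod>w\<in>Z - {z}. 1 - x / w)" for z x
    unfolding B_def by (simp add: poly_prod)
  have "R = L"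
  proof (rule poly_eqI_degree)
    show "poly R x = poly L x" if "x \<in> Z" for x
    proof -
      have "poly L x = (\<Sum>z\<in>Z. c z * poly (B z) x)" by (simp add: L_def poly_sum)
      also have "\<dots> = (\<Sum>z\<in>Z. if z = x then c x * poly (B x) x else 0)"
      proof (intro sum.cong refl)
        fix z assume "z \<in> Z"
        show "c z * poly (B z) x = (if z = x then c x * poly (B x) x else 0)"
        proof (cases "z = x")
          case False
          then have "poly (B z) x = 0"
            unfolding polyB using that fin wnz[OF that] by (intro prod_zero) auto
          then show ?thesis using False by simp
        qed simp
      qed
      also have "\<dots> = c x * poly (B x) x" using that fin by simp
      also have "(\<Prod>w\<in>Z - {x}. 1 - x / w) \<noteq> 0"
        using fin wnz by (auto simp: field_simps)
      then have "c x * poly (B x) x = poly R x" unfolding c_def polyB by simp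
      finally show ?thesis by simp
    qed
    show "card Z > degree R" by fact
    have "degree L \<le> card Z - 1" unfolding L_def
      using degB by (intro degree_sum_le fin) (auto intro: order.trans[OF degree_smult_le])
    then show "card Z > degree L" using deg by linarith
  qed
  then have "coeff R (card Z - 1) = (\<Sum>z\<in>Z. c z * coeff (B z) (card Z - 1))"
    by (simp add: L_def coeff_sum)
  also have "\<dots> = (\<Sum>z\<in>Z. c z * (\<Prod>w\<in>Z - {z}. - 1 / w))"
    by (intro sum.cong refl) (simp only: lcB)
  also have "\<dots> = (\<Sum>z\<in>Z. - (z * c z * (\<Prod>w\<in>Z. - 1 / w)))"
  proof (intro sum.cong refl)
    fix z assume z: "z \<in> Z"
    have "(\<Prod>w\<in>Z. - 1 / w) = (- 1 / z) * (\<Prod>w\<in>Z - {z}. - 1 / w)"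
      using fin z by (rule prod.remove)
    then show "c z * (\<Prod>w\<in>Z - {z}. - 1 / w) = - (z * c z * (\<Prod>w\<in>Z. - 1 / w))"
      using wnz[OF z] by simp
  qed
  finally show ?thesis by (simp add: c_def sum_negf sum_distrib_right)
qed

text \<open>
  This is the residue theorem on the sphere for \<open>x\<^sup>-\<^sup>t N(x) / D(x)\<close>: the degree condition
  says that there is no residue at infinity, so the residues at the (simple) zeros of \<open>D\<close>
  cancel the residue at the origin, the coefficient of \<open>x\<^sup>t\<^sup>-\<^sup>1\<close> in the power series
  \<open>H = N / D\<close>. For \<open>t > 0\<close>, subtracting from \<open>H\<close> its Taylor polynomial \<open>T\<close> of degree \<open>t - 1\<close>
  gives \<open>N - D T = x\<^sup>t R\<close> with \<open>deg R < card Z\<close>; since \<open>N = x\<^sup>t R\<close> at the nodes, the sum is the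
  interpolation sum of \<open>R\<close>, whose top coefficient comes from \<open>D T\<close> alone.
\<close>

lemma sum_over_poles_eq_coefficient:
  fixes N D :: "complex poly" and t :: int
  assumes fin: "finite Z" and nz: "0 \<notin> Z"
    and D: "D = (\<Prod>w\<in>Z. [:1, - 1 / w:])"
    and deg: "int (degree N) + 2 \<le> int (card Z) + t"
    and H: "fps_of_poly D * H = fps_of_poly N"
  shows "(\<Sum>z\<in>Z. z powi (1 - t) * poly N z / (\<Prod>w\<in>Z - {z}. 1 - z / w))
         = (if t \<le> 0 then 0 else fps_nth H (nat t - 1))"
proof (cases "Z = {}")
  case True
  then have "H = fps_of_poly N" using H D by simp
  moreover have "degree N < nat t - 1" "t > 0" using deg True by auto
  ultimately show ?thesis using True by (simp add: coeff_eq_0)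
next
  case False
  then have card0: "card Z > 0" using fin by (simp add: card_gt_0_iff)
  have wnz: "w \<noteq> 0" if "w \<in> Z" for w using that nz by auto
  have prodnz: "(\<Prod>w\<in>Z. - 1 / w) \<noteq> 0" using fin wnz by auto
  have degD: "degree D = card Z"
  proof -
    have "degree D = (\<Sum>w\<in>Z. degree [:1, - 1 / w:])"
      unfolding D by (rule degree_prod_sum_eq) (auto simp: wnz)
    also have "\<dots> = (\<Sum>w\<in>Z. 1)" by (intro sum.cong) (auto simp: wnz)
    finally show ?thesis using fin by simp
  qed
  have lcD: "coeff D (card Z) = (\<Prod>w\<in>Z. - 1 / w)"
  proof -
    have "lead_coeff D = (\<Prod>w\<in>Z. lead_coeff [:1, - 1 / w:])"
      unfolding D by (rule lead_coeff_prod)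
    also have "\<dots> = (\<Prod>w\<in>Z. - 1 / w)" by (intro prod.cong) (auto simp: wnz)
    finally show ?thesis unfolding degD .
  qed
  have polyD: "poly D z = 0" if "z \<in> Z" for z
    unfolding D poly_prod using fin that wnz[OF that] by (intro prod_zero) auto
  show ?thesis
  proof (cases "t \<le> 0")
    case True
    \<comment> \<open>here \<open>x\<^sup>-\<^sup>t N\<close> is itself a polynomial, either \<open>0\<close> or of degree below \<open>card Z - 1\<close>\<close>
    define R where "R = monom 1 (nat (-t)) * N"
    have degR: "degree R < card Z - 1 \<or> (degree R = 0 \<and> R = 0)"
    proof (cases "N = 0")
      case False
      then have "degree R = nat (-t) + degree N"
        unfolding R_def by (subst degree_mult_eq) (auto simp: degree_monom_eq)
      then show ?thesis using deg True by auto
    qed (simp add: R_def)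
    then have "coeff R (card Z - 1) = 0" "degree R < card Z"
      using card0 by (auto simp: coeff_eq_0)
    with lagrange_leading_coeff[OF fin nz, of R] prodnz
    have *: "(\<Sum>z\<in>Z. z * poly R z / (\<Prod>w\<in>Z - {z}. 1 - z / w)) = 0" by simp
    have "(\<Sum>z\<in>Z. z powi (1 - t) * poly N z / (\<Prod>w\<in>Z - {z}. 1 - z / w))
       = (\<Sum>z\<in>Z. z * poly R z / (\<Prod>w\<in>Z - {z}. 1 - z / w))"
    proof (intro sum.cong refl)
      fix z assume z: "z \<in> Z"
      have "z powi (1 - t) = z * z ^ nat (-t)"
        using True by (simp add: power_int_def Suc_nat_eq_nat_zadd1 flip: power_Suc)
      then show "z powi (1 - t) * poly N z / (\<Prod>w\<in>Z - {z}. 1 - z / w)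
         = z * poly R z / (\<Prod>w\<in>Z - {z}. 1 - z / w)"
        by (simp add: R_def poly_monom)
    qed
    with * True show ?thesis by simp
  next
    case t: False
    define u where "u = nat t - 1"
    have tu: "t = int (Suc u)" using t by (simp add: u_def)
    define T where "T = (\<Sum>k\<le>u. monom (fps_nth H k) k)"
    have coeffT: "coeff T k = (if k \<le> u then fps_nth H k else 0)" for k
      by (simp add: T_def coeff_sum)
    have degT: "degree T \<le> u" by (rule degree_le) (simp add: coeffT)
    have "coeff (N - D * T) k = 0" if "k < Suc u" for k
    proof -
      have "coeff N k = fps_nth (fps_of_poly D * H) k" using H by simp
      also have "\<dots> = (\<Sum>i=0..k. coeff D i * fps_nth H (k - i))" by (simp add: fps_mult_nth)
      also have "\<dots> = coeff (D * T) k"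
        unfolding coeff_mult using that by (intro sum.cong) (auto simp: coeffT)
      finally show ?thesis by simp
    qed
    then have "monom 1 (Suc u) dvd N - D * T" by (simp add: monom_1_dvd_iff')
    then obtain R where R: "N - D * T = monom 1 (Suc u) * R" by (elim dvdE)
    have coeffR: "coeff R k = coeff (N - D * T) (Suc u + k)" for k
      by (simp add: R coeff_monom_mult)
    \<comment> \<open>the top coefficient of \<open>R\<close> comes from \<open>D T\<close> only, as \<open>N\<close> has too small a degree\<close>
    have degDT: "degree (D * T) \<le> card Z + u"
      using degree_mult_le[of D T] degT degD by linarith
    have degN: "degree N < card Z + u" using deg tu by linarith
    have "degree R < card Z"
    proof -
      have "coeff R k = 0" if "k > card Z - 1" for k
        unfolding coeffR using that degDT degN by (simp add: coeff_eq_0)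
      then have "degree R \<le> card Z - 1" by (intro degree_le) auto
      then show ?thesis using card0 by linarith
    qed
    then have L: "(\<Sum>z\<in>Z. z * poly R z / (\<Prod>w\<in>Z - {z}. 1 - z / w)) * (\<Prod>w\<in>Z. - 1 / w)
         = - coeff R (card Z - 1)"
      by (rule lagrange_leading_coeff[OF fin nz])
    have "coeff (D * T) (card Z + u) = coeff D (card Z) * coeff T u"
    proof -
      have "coeff (D * T) (card Z + u) = (\<Sum>i\<le>card Z + u. coeff D i * coeff T (card Z + u - i))"
        by (rule coeff_mult)
      also have "\<dots> = (\<Sum>i\<in>{card Z}. coeff D i * coeff T (card Z + u - i))"
      proof (intro sum.mono_neutral_right ballI)
        fix i assume "i \<in> {..card Z + u} - {card Z}"
        then have "i < card Z \<or> i > card Z" by auto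
        then show "coeff D i * coeff T (card Z + u - i) = 0"
          using degD by (auto simp: coeffT coeff_eq_0)
      qed auto
      finally show ?thesis by simp
    qed
    then have "coeff R (card Z - 1) = - ((\<Prod>w\<in>Z. - 1 / w) * fps_nth H u)"
      unfolding coeffR using card0 degN by (simp add: coeff_eq_0 lcD coeffT add.commute)
    with L have L': "(\<Sum>z\<in>Z. z * poly R z / (\<Prod>w\<in>Z - {z}. 1 - z / w)) = fps_nth H u"
      using prodnz by (simp add: mult.commute)
    have "(\<Sum>z\<in>Z. z powi (1 - t) * poly N z / (\<Prod>w\<in>Z - {z}. 1 - z / w))
       = (\<Sum>z\<in>Z. z * poly R z / (\<Prod>w\<in>Z - {z}. 1 - z / w))"
    proof (intro sum.cong refl)
      fix z assume z: "z \<in> Z"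
      have "poly N z = z ^ Suc u * poly R z"
        using arg_cong[OF R, of "\<lambda>p. poly p z"] polyD[OF z] by (simp add: poly_monom)
      moreover have "z powi (1 - t) * z ^ Suc u = z"
        unfolding tu using wnz[OF z] by (simp add: power_int_minus)
      ultimately have "z powi (1 - t) * poly N z = z * poly R z"
        by (metis mult.assoc)
      then show "z powi (1 - t) * poly N z / (\<Prod>w\<in>Z - {z}. 1 - z / w)
         = z * poly R z / (\<Prod>w\<in>Z - {z}. 1 - z / w)" by simp
    qed
    with L' show ?thesis using t by (simp add: u_def)
  qed
qed

section \<open>Shifted factorials with a shifted base\<close>

text \<open>
  For such \<open>y\<close> no factor \<open>1 - y q\<^sup>k\<close>, \<open>k \<in> \<int>\<close>, vanishes, and shifted factorials of
  negative index obey the same recursion as those of nonnegative index.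
\<close>

definition off_q_lattice :: "complex \<Rightarrow> complex \<Rightarrow> bool" where
  "off_q_lattice q y \<longleftrightarrow> (\<forall>k::int. y * q powi k \<noteq> 1)"

lemma qpoch_nat: "qpoch q a (int n) = (\<Prod>k<n. 1 - a * q ^ k)"
  by (simp add: qpoch_def)

lemma qpoch_0 [simp]: "qpoch q a 0 = 1"
  by (simp add: qpoch_def)

lemma qpoch_nat_Suc: "qpoch q a (int (Suc n)) = qpoch q a (int n) * (1 - a * q ^ n)"
  unfolding qpoch_nat by simp

lemma qpoch_nat_add: "qpoch q a (int (m + n)) = qpoch q a (int m) * qpoch q (a * q ^ m) (int n)"
  unfolding qpoch_nat by (induction n) (simp_all add: power_add mult.assoc)

lemma qpoch_step:
  assumes "q \<noteq> 0" and "n \<ge> 0 \<or> off_q_lattice q y"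
  shows "qpoch q y (n + 1) = qpoch q y n * (1 - y * q powi n)"
proof (cases "n \<ge> 0")
  case True
  then obtain k where "n = int k" using nonneg_int_cases by blast
  then show ?thesis using qpoch_nat_Suc[of q y k] by (simp add: add.commute)
next
  case False
  define p where "p = nat (- n - 1)"
  have n: "n = - int (Suc p)" using False by (simp add: p_def)
  have "1 - y * q powi n \<noteq> 0" using assms False by (auto simp: off_q_lattice_def)
  moreover have "qpoch q y n = qpoch q y (n + 1) * (1 / (1 - y * q powi n))"
  proof (cases "p = 0")
    case True then show ?thesis by (simp add: n qpoch_def)
  next
    case False
    have "nat (int p + 1) = Suc p" by simp
    then show ?thesis using False by (simp add: n qpoch_def)
  qed
  ultimately show ?thesis by simp
qed

lemma off_q_lattice_divide:
  assumes "q \<noteq> 0" "off_q_lattice q y" shows "off_q_lattice q (y / q ^ k)"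
  unfolding off_q_lattice_def
proof
  fix i :: int
  have "y / q ^ k * q powi i = y * q powi (i - int k)"
    using assms(1) by (simp add: power_int_diff)
  then show "y / q ^ k * q powi i \<noteq> 1" using assms(2) by (simp add: off_q_lattice_def)
qed

text \<open>
  Both sides equal \<open>(y/q; q)\<^sub>n\<^sub>+\<^sub>1\<close>, split off at the last or at the first factor.
\<close>

lemma qpoch_divide_step:
  assumes q: "q \<noteq> 0" and n: "n \<ge> 0 \<or> off_q_lattice q y"
  shows "qpoch q (y / q) n * (1 - y * q powi (n - 1)) = (1 - y / q) * qpoch q y n"
proof -
  have up: "qpoch q (y / q) (n+1) * (1 - y * q powi n) = (1 - y / q) * qpoch q y (n+1)"
    if "qpoch q (y / q) n * (1 - y * q powi (n - 1)) = (1 - y / q) * qpoch q y n"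
      "n \<ge> 0 \<or> off_q_lattice q y" for n
  proof -
    have "n \<ge> 0 \<or> off_q_lattice q (y / q)" using that(2) off_q_lattice_divide[OF q, of y 1] by auto
    then have "qpoch q (y / q) (n+1) = qpoch q (y / q) n * (1 - y * q powi (n - 1))"
      using qpoch_step[OF q, of n "y / q"] q by (simp add: power_int_diff field_simps)
    then show ?thesis using that qpoch_step[OF q, of n y] by simp
  qed
  have down: "qpoch q (y / q) (n-1) * (1 - y * q powi (n - 1 - 1)) = (1 - y / q) * qpoch q y (n-1)"
    if "qpoch q (y / q) n * (1 - y * q powi (n - 1)) = (1 - y / q) * qpoch q y n"
      "off_q_lattice q y" for n
  proof -
    have "off_q_lattice q (y / q)" using that(2) off_q_lattice_divide[OF q, of y 1] by auto
    then have 1: "qpoch q (y / q) n = qpoch q (y / q) (n - 1) * (1 - y * q powi (n - 1 - 1))"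
      using qpoch_step[OF q, of "n - 1" "y / q"] q
      by (simp add: power_int_diff field_simps power2_eq_square)
    have 2: "qpoch q y n = qpoch q y (n - 1) * (1 - y * q powi (n - 1))"
      using qpoch_step[OF q, of "n - 1" y] that(2) by simp
    have "1 - y * q powi (n - 1) \<noteq> 0" using that(2) by (auto simp: off_q_lattice_def)
    then show ?thesis using that(1) unfolding 1 2 by simp
  qed
  have zero: "qpoch q (y / q) 0 * (1 - y * q powi (0 - 1)) = (1 - y / q) * qpoch q y 0"
    by (simp only: qpoch_0) (simp add: divide_inverse power_int_minus)
  from n show ?thesis
  proof
    assume "n \<ge> 0"
    then show ?thesis
    proof (induction n rule: int_ge_induct)
      case base then show ?case by (rule zero)
    next
      case (step i) then show ?case using up[of i] by simp
    qed
  next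
    assume off: "off_q_lattice q y"
    show ?thesis
    proof (induction n rule: int_induct[where k = 0])
      case base then show ?case by (rule zero)
    next
      case (step1 i) then show ?case using up[of i] off by simp
    next
      case (step2 i) then show ?case using down[of i] off by simp
    qed
  qed
qed

text \<open>
  Replacing \<open>y\<close> by \<open>y q\<^sup>-\<^sup>k\<close> moves from the first term of a hypergeometric series to its
  term of index \<open>k\<close>; the quotient of the two new factorials on base \<open>q\<close> is what that term
  contributes.
\<close>

lemma qpoch_shift_base:
  assumes q: "q \<noteq> 0" and y: "y \<noteq> 0" and n: "n \<ge> 0 \<or> off_q_lattice q y"
  shows "qpoch q (y / q ^ k) n * qpoch q (q powi (1 - n) / y) (int k) * q powi (n * int k)
         = qpoch q y n * qpoch q (q / y) (int k)"
proof (induction k)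
  case (Suc k)
  define u where "u = y / q ^ k"
  have u: "u \<noteq> 0" using q y by (simp add: u_def)
  have "n \<ge> 0 \<or> off_q_lattice q u" using n off_q_lattice_divide[OF q, of y k] by (auto simp: u_def)
  from qpoch_divide_step[OF q this]
  have st: "qpoch q (u / q) n * (1 - u * q powi (n - 1)) = (1 - u / q) * qpoch q u n" .
  have e1: "1 - u * q powi (n - 1) = - u / q * q powi n * (1 - q powi (1 - n) / y * q ^ k)"
    using q y by (simp add: u_def power_int_diff field_simps)
  have e2: "1 - u / q = - u / q * (1 - q / y * q ^ k)"
    using q y by (simp add: u_def field_simps)
  have "(- u / q) * (qpoch q (u / q) n * q powi n * (1 - q powi (1 - n) / y * q ^ k))
      = (- u / q) * ((1 - q / y * q ^ k) * qpoch q u n)"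
    using st unfolding e1 e2 by (simp add: algebra_simps)
  then have st': "qpoch q (u / q) n * q powi n * (1 - q powi (1 - n) / y * q ^ k)
      = (1 - q / y * q ^ k) * qpoch q u n"
    using u q by simp
  have "qpoch q (y / q ^ Suc k) n * qpoch q (q powi (1 - n) / y) (int (Suc k)) * q powi (n * int (Suc k))
     = (qpoch q (u / q) n * q powi n * (1 - q powi (1 - n) / y * q ^ k))
       * (qpoch q (q powi (1 - n) / y) (int k) * q powi (n * int k))"
    using q unfolding qpoch_nat_Suc
    by (simp add: u_def power_int_add distrib_left mult_ac)
  also have "\<dots> = (1 - q / y * q ^ k) * (qpoch q (y / q ^ k) n * qpoch q (q powi (1 - n) / y) (int k) * q powi (n * int k))"
    unfolding st' by (simp add: u_def mult_ac)
  also have "\<dots> = qpoch q y n * qpoch q (q / y) (int (Suc k))"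
    unfolding Suc.IH qpoch_nat_Suc by (simp add: mult_ac)
  finally show ?case .
qed simp

lemma qpoch_base_divide_power:
  assumes q: "q \<noteq> 0" and y: "y \<noteq> 0"
  shows "qpoch q (y / q ^ k) (int k) * q ^ (k * (k + 1) div 2) = (- y) ^ k * qpoch q (q / y) (int k)"
proof (induction k)
  case (Suc k)
  have "qpoch q (y / q ^ Suc k) (int (Suc k))
      = (1 - y / q ^ Suc k) * qpoch q (y / q ^ k) (int k)"
    using qpoch_nat_add[of q "y / q ^ Suc k" 1 k] q by (simp add: qpoch_def field_simps)
  moreover have "Suc k * (Suc k + 1) div 2 = k * (k + 1) div 2 + Suc k"
    by simp
  ultimately have "qpoch q (y / q ^ Suc k) (int (Suc k)) * q ^ (Suc k * (Suc k + 1) div 2)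
     = (1 - y / q ^ Suc k) * q ^ Suc k * (qpoch q (y / q ^ k) (int k) * q ^ (k * (k + 1) div 2))"
    by (simp add: power_add mult_ac)
  also have "(1 - y / q ^ Suc k) * q ^ Suc k = - y * (1 - q / y * q ^ k)"
    using q y by (simp add: field_simps)
  finally show ?case unfolding Suc.IH qpoch_nat_Suc by (simp add: mult_ac)
qed simp

text \<open>
  The factors with exponent of \<open>q\<close> below \<open>0\<close> are reversed; the remaining ones form a shifted
  factorial that depends on \<open>n\<close> and \<open>k\<close> only through \<open>n - k\<close>. This form shows the decay in \<open>k\<close>
  uniformly in \<open>n\<close>.
\<close>

lemma qpoch_base_divide_power_ge:
  assumes q: "q \<noteq> 0" and y: "y \<noteq> 0" and k: "k \<le> n"
  shows "qpoch q (y / q ^ k) (int n)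
       = (- y) ^ k / q ^ (k * (k + 1) div 2) * qpoch q (q / y) (int k) * qpoch q y (int (n - k))"
proof -
  have "qpoch q (y / q ^ k) (int n) = qpoch q (y / q ^ k) (int k) * qpoch q y (int (n - k))"
    using qpoch_nat_add[of q "y / q ^ k" k "n - k"] k q by simp
  also have "qpoch q (y / q ^ k) (int k) = (- y) ^ k / q ^ (k * (k + 1) div 2) * qpoch q (q / y) (int k)"
    using qpoch_base_divide_power[OF q y, of k] q by (simp add: field_simps)
  finally show ?thesis .
qed

section \<open>The power series of the infinite product\<close>

definition fps_scale :: "complex \<Rightarrow> complex fps \<Rightarrow> complex fps" where
  "fps_scale c f = f oo (fps_const c * fps_X)"

lemma fps_scale_nth [simp]: "fps_nth (fps_scale c f) n = c ^ n * fps_nth f n"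
  by (simp add: fps_scale_def fps_compose_linear)

lemma fps_scale_mult: "fps_scale c (f * g) = fps_scale c f * fps_scale c g"
  unfolding fps_scale_def by (rule fps_compose_mult_distrib) simp

lemma fps_scale_prod: "fps_scale c (\<Prod>i\<in>I. f i) = (\<Prod>i\<in>I. fps_scale c (f i))"
  unfolding fps_scale_def by (rule fps_compose_prod_distrib) simp

lemma fps_scale_inverse: "fps_nth f 0 \<noteq> 0 \<Longrightarrow> fps_scale c (inverse f) = inverse (fps_scale c f)"
  unfolding fps_scale_def by (rule fps_inverse_compose) simp_all

lemma fps_scale_scale [simp]: "fps_scale c (fps_scale d f) = fps_scale (c * d) f"
  by (rule fps_ext) (simp add: power_mult_distrib)

text \<open>
  The Taylor series of \<open>(x; q)\<^sub>\<infinity>\<close> at the origin (Euler). Only the functional equation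
  \<open>E(x) = (1 - x) E(q x)\<close> is used, so the series never has to be identified with the function.
\<close>

definition euler_fps :: "complex \<Rightarrow> complex fps" where
  "euler_fps q = Abs_fps (\<lambda>n. \<Prod>k<n. q ^ k / (q ^ Suc k - 1))"

lemma euler_fps_0 [simp]: "fps_nth (euler_fps q) 0 = 1"
  by (simp add: euler_fps_def)

lemma euler_fps_functional_equation:
  assumes q: "cmod q < 1"
  shows "fps_of_poly [:1, - c:] * fps_scale (c * q) (euler_fps q) = fps_scale c (euler_fps q)"
proof (rule fps_ext)
  fix n
  have e: "fps_of_poly [:1, - c:] = 1 - fps_const c * fps_X"
    by (simp add: fps_of_poly_linear')
  show "fps_nth (fps_of_poly [:1, - c:] * fps_scale (c * q) (euler_fps q)) n
      = fps_nth (fps_scale c (euler_fps q)) n"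
  proof (cases n)
    case 0 then show ?thesis by simp
  next
    case (Suc k)
    have "cmod (q ^ Suc k) < 1" using q by (simp add: norm_power power_less_one_iff del: power_Suc)
    then have nz: "q ^ Suc k - 1 \<noteq> 0" by auto
    define e where "e = fps_nth (euler_fps q) k"
    have eS: "fps_nth (euler_fps q) (Suc k) = e * (q ^ k / (q ^ Suc k - 1))"
      by (simp add: euler_fps_def e_def)
    have "fps_nth (fps_of_poly [:1, - c:] * fps_scale (c * q) (euler_fps q)) n
       = (c * q) ^ Suc k * (e * (q ^ k / (q ^ Suc k - 1))) - c * ((c * q) ^ k * e)"
      unfolding \<open>fps_of_poly [:1, - c:] = _\<close> Suc
      by (simp add: ring_distribs mult.assoc eS flip: e_def del: power_Suc)
    also have "\<dots> = c ^ Suc k * (e * (q ^ k / (q ^ Suc k - 1)))"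
    proof -
      have "(c * q) ^ Suc k * (e * (q ^ k / (q ^ Suc k - 1))) - c * ((c * q) ^ k * e)
        = c ^ Suc k * e * q ^ k * (q ^ Suc k / (q ^ Suc k - 1) - 1)"
        by (simp add: power_mult_distrib algebra_simps)
      also have "q ^ Suc k / (q ^ Suc k - 1) - 1 = 1 / (q ^ Suc k - 1)"
        using nz by (simp add: divide_simps)
      finally show ?thesis by simp
    qed
    finally show ?thesis by (simp only: Suc fps_scale_nth eS)
  qed
qed

text \<open>
  As a function of \<open>x\<close>, \<open>(c x; q)\<^sub>n\<close> is a polynomial for \<open>n \<ge> 0\<close> and the reciprocal of a
  polynomial for \<open>n \<le> 0\<close>; both cases together are the fraction with this numerator and the
  denominator below.
\<close>

definition qpoch_num :: "complex \<Rightarrow> complex \<Rightarrow> int \<Rightarrow> complex poly" where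
  "qpoch_num q c n = (\<Prod>k<nat n. [:1, - (c * q ^ k):])"

definition qpoch_den :: "complex \<Rightarrow> complex \<Rightarrow> int \<Rightarrow> complex poly" where
  "qpoch_den q c n = (\<Prod>k=1..nat (- n). [:1, - (c * q powi (- int k)):])"

lemma qpoch_eq_num_div_den:
  "qpoch q (c * x) n = poly (qpoch_num q c n) x / poly (qpoch_den q c n) x"
  by (cases "n \<ge> 0") (auto simp: qpoch_def qpoch_num_def qpoch_den_def poly_prod mult_ac prod_dividef)

lemma fps_num_scale_euler_nat:
  assumes "cmod q < 1"
  shows "fps_of_poly (\<Prod>k<n. [:1, - (c * q ^ k):]) * fps_scale (c * q ^ n) (euler_fps q)
       = fps_scale c (euler_fps q)"
proof (induction n)
  case (Suc n)
  have "fps_of_poly (\<Prod>k<Suc n. [:1, - (c * q ^ k):]) * fps_scale (c * q ^ Suc n) (euler_fps q)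
     = fps_of_poly (\<Prod>k<n. [:1, - (c * q ^ k):])
       * (fps_of_poly [:1, - (c * q ^ n):] * fps_scale (c * q ^ n * q) (euler_fps q))"
    by (simp add: fps_of_poly_mult mult_ac del: mult_pCons_left mult_pCons_right)
  then show ?case using euler_fps_functional_equation[OF assms, of "c * q ^ n"] Suc.IH by simp
qed simp

text \<open>
  The identity \<open>(c x; q)\<^sub>n = (c x; q)\<^sub>\<infinity> / (c q\<^sup>n x; q)\<^sub>\<infinity>\<close> of power series in \<open>x\<close>, cleared of
  denominators.
\<close>

lemma fps_qpoch_num_den:
  assumes q: "q \<noteq> 0" "cmod q < 1"
  shows "fps_of_poly (qpoch_num q c n) * fps_scale (c * q powi n) (euler_fps q)
       = fps_of_poly (qpoch_den q c n) * fps_scale c (euler_fps q)"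
proof (cases "n \<ge> 0")
  case True
  then obtain k where "n = int k" using nonneg_int_cases by blast
  then show ?thesis using fps_num_scale_euler_nat[OF q(2), of c k]
    by (simp add: qpoch_num_def qpoch_den_def)
next
  case False
  then obtain p where n: "n = - int p" using nonpos_int_cases[of n] by (auto simp: not_le)
  have "(\<Prod>k=1..p. [:1, - (c * q powi (- int k)):]) = (\<Prod>k<p. [:1, - (c / q ^ p * q ^ k):])"
    by (rule prod.reindex_bij_witness[of _ "\<lambda>k. p - k" "\<lambda>k. p - k"])
       (auto simp: power_int_minus field_simps power_diff q(1))
  then have "qpoch_den q c n = (\<Prod>k<p. [:1, - (c / q ^ p * q ^ k):])"
    by (simp add: n qpoch_den_def)
  moreover have "c * q powi n = c / q ^ p" by (simp add: n power_int_minus divide_inverse)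
  moreover have "qpoch_num q c n = 1" by (simp add: n qpoch_num_def)
  ultimately show ?thesis using fps_num_scale_euler_nat[OF q(2), of "c / q ^ p" p] q(1)
    by simp
qed

section \<open>Sums over the poles of a quotient of shifted factorials\<close>

lemma prod_one_minus_q_powers_except:
  fixes q :: complex
  assumes q: "q \<noteq> 0" and k: "k < n"
  shows "(\<Prod>j\<in>{..<n} - {k}. 1 - q ^ j / q ^ k)
       = qpoch q (1 / q ^ k) (int k) * qpoch q q (int (n - 1 - k))"
proof -
  have "{..<n} - {k} = {..<k} \<union> {Suc k..<n}" using k by auto
  also have "(\<Prod>j\<in>\<dots>. 1 - q ^ j / q ^ k)
     = (\<Prod>j<k. 1 - q ^ j / q ^ k) * (\<Prod>j=Suc k..<n. 1 - q ^ j / q ^ k)"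
    by (rule prod.union_disjoint) auto
  also have "(\<Prod>j<k. 1 - q ^ j / q ^ k) = qpoch q (1 / q ^ k) (int k)"
    by (simp add: qpoch_nat)
  also have "(\<Prod>j=Suc k..<n. 1 - q ^ j / q ^ k) = (\<Prod>j<n - 1 - k. 1 - q * q ^ j)"
    by (rule prod.reindex_bij_witness[of _ "\<lambda>j. j + Suc k" "\<lambda>j. j - Suc k"])
       (use k in \<open>auto simp: q power_add power_diff field_simps\<close>)
  also have "\<dots> = qpoch q q (int (n - 1 - k))" by (simp only: qpoch_nat)
  finally show ?thesis .
qed

lemma degree_prod_linear_le:
  fixes c :: "'i \<Rightarrow> complex"
  shows "degree (\<Prod>i\<in>S. [:1, - c i:]) \<le> card S"
proof (cases "finite S")
  case True
  then have "degree (\<Prod>i\<in>S. [:1, - c i:]) \<le> (\<Sum>i\<in>S. degree [:1, - c i:])"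
    using degree_prod_sum_le[of S "\<lambda>i. [:1, - c i:]"] by (simp only: o_def)
  also have "\<dots> \<le> (\<Sum>i\<in>S. 1)" by (rule sum_mono) simp
  finally show ?thesis by simp
qed simp

text \<open>
  The setting for \<open>\<Prod>\<^sub>l (q x / B\<^sub>l; q)\<^sub>\<infinity> / \<Prod>\<^sub>i (x / A\<^sub>i; q)\<^sub>\<infinity>\<close>, whose poles
  \<open>A\<^sub>i q\<^sup>-\<^sup>k\<close> are simple because no quotient \<open>A\<^sub>i / A\<^sub>l\<close> is a power of \<open>q\<close>. In the application
  \<open>A\<^sub>i = q\<close> to the \<open>a\<^sub>i\<close> and \<open>B\<^sub>l = q\<close> to the \<open>b\<^sub>l\<close>.
\<close>

locale q_product_quotient =
  fixes q :: complex and r s :: nat and A B :: "nat \<Rightarrow> complex"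
  assumes q_nz: "q \<noteq> 0" and q_lt_1: "cmod q < 1" and s_less_r: "s < r"
    and A_nz: "\<And>i. A i \<noteq> 0" and B_nz: "\<And>l. B l \<noteq> 0"
    and A_ratio: "\<And>i l. i \<in> {1..r} \<Longrightarrow> l \<in> {1..r} \<Longrightarrow> l \<noteq> i \<Longrightarrow> off_q_lattice q (A i / A l)"
begin

text \<open>
  The Taylor series \<open>P\<close> of the quotient of infinite products.
\<close>

definition quotient_fps :: "complex fps" where
  "quotient_fps = (\<Prod>l=1..s. fps_scale (q / B l) (euler_fps q))
                  * inverse (\<Prod>l=1..r. fps_scale (1 / A l) (euler_fps q))"

text \<open>
  The series \<open>Q\<close> for which \<open>P(x) Q(q\<^sup>j x)\<close> is the Taylor series of the quotient of finite
  shifted factorials with indices \<open>m\<^sub>l + j\<close> and \<open>n\<^sub>i + j + 1\<close>; it collects the tails by which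
  finite and infinite products differ, and all dependence on \<open>j\<close> is in the scaling.
\<close>

definition tail_fps :: "(nat \<Rightarrow> int) \<Rightarrow> (nat \<Rightarrow> int) \<Rightarrow> complex fps" where
  "tail_fps m n = (\<Prod>l=1..r. fps_scale (q powi (n l + 1) / A l) (euler_fps q))
                  * inverse (\<Prod>l=1..s. fps_scale (q powi (m l + 1) / B l) (euler_fps q))"

text \<open>
  Up to sign, the residue at \<open>x = A\<^sub>i q\<^sup>-\<^sup>k\<close> of
  \<open>x\<^sup>-\<^sup>t \<Prod>\<^sub>l (q x / B\<^sub>l; q)\<close> (with indices \<open>m\<^sub>l + j\<close>) divided by \<open>\<Prod>\<^sub>l (x / A\<^sub>l; q)\<close> (with
  indices \<open>n\<^sub>l + j + 1\<close>). The first two factors of the denominator are \<open>(x / A\<^sub>i; q)\<close> without its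
  vanishing factor.
\<close>

definition pole_term ::
  "(nat \<Rightarrow> int) \<Rightarrow> (nat \<Rightarrow> int) \<Rightarrow> int \<Rightarrow> int \<Rightarrow> nat \<Rightarrow> nat \<Rightarrow> complex" where
  "pole_term m n t j i k =
     (A i / q ^ k) powi (1 - t) * (\<Prod>l=1..s. qpoch q (q * A i / B l / q ^ k) (m l + j))
     / (qpoch q (1 / q ^ k) (int k) * qpoch q q (j + n i - int k)
        * (\<Prod>l\<in>{1..r} - {i}. qpoch q (A i / A l / q ^ k) (n l + j + 1)))"

lemma finite_quotient_fps:
  assumes m: "\<And>l. l \<in> {1..s} \<Longrightarrow> 0 \<le> m l + j"
  shows "fps_of_poly (\<Prod>l=1..r. qpoch_num q (1 / A l) (n l + j + 1))
           * (quotient_fps * fps_scale (q powi j) (tail_fps m n))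
         = fps_of_poly ((\<Prod>l=1..s. qpoch_num q (q / B l) (m l + j))
           * (\<Prod>l=1..r. qpoch_den q (1 / A l) (n l + j + 1)))"
proof -
  let ?E = "euler_fps q"
  define EA where "EA = (\<Prod>l=1..r. fps_scale (1 / A l) ?E)"
  define EA' where "EA' = (\<Prod>l=1..r. fps_scale (q powi (n l + j + 1) / A l) ?E)"
  define EB where "EB = (\<Prod>l=1..s. fps_scale (q / B l) ?E)"
  define EB' where "EB' = (\<Prod>l=1..s. fps_scale (q powi (m l + j + 1) / B l) ?E)"
  have c0: "fps_nth (\<Prod>l\<in>I. fps_scale (c l) ?E) 0 = 1" for I and c :: "nat \<Rightarrow> complex"
    by (induction I rule: infinite_finite_induct) simp_all
  have 1: "fps_of_poly (\<Prod>l=1..r. qpoch_num q (1 / A l) (n l + j + 1)) * EA'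
         = fps_of_poly (\<Prod>l=1..r. qpoch_den q (1 / A l) (n l + j + 1)) * EA"
    unfolding EA_def EA'_def fps_of_poly_prod prod.distrib[symmetric]
  proof (intro prod.cong refl)
    fix l
    show "fps_of_poly (qpoch_num q (1 / A l) (n l + j + 1)) * fps_scale (q powi (n l + j + 1) / A l) ?E
        = fps_of_poly (qpoch_den q (1 / A l) (n l + j + 1)) * fps_scale (1 / A l) ?E"
      using fps_qpoch_num_den[OF q_nz q_lt_1, of "1 / A l" "n l + j + 1"] by simp
  qed
  have 2: "fps_of_poly (\<Prod>l=1..s. qpoch_num q (q / B l) (m l + j)) * EB' = EB"
    unfolding EB_def EB'_def fps_of_poly_prod prod.distrib[symmetric]
  proof (intro prod.cong refl)
    fix l assume l: "l \<in> {1..s}"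
    have e: "q / B l * q powi (m l + j) = q powi (m l + j + 1) / B l"
      using q_nz by (simp add: power_int_add field_simps)
    moreover have "qpoch_den q (q / B l) (m l + j) = 1"
      using m[OF l] by (simp add: qpoch_den_def)
    ultimately show "fps_of_poly (qpoch_num q (q / B l) (m l + j))
        * fps_scale (q powi (m l + j + 1) / B l) ?E = fps_scale (q / B l) ?E"
      using fps_qpoch_num_den[OF q_nz q_lt_1, of "q / B l" "m l + j"] unfolding e by simp
  qed
  have "fps_scale (q powi j) (tail_fps m n) = EA' * inverse EB'"
    unfolding tail_fps_def fps_scale_mult
    by (subst fps_scale_inverse)
       (use q_nz in \<open>simp_all add: c0 fps_scale_prod EA'_def EB'_def power_int_add mult_ac\<close>)
  then have "fps_of_poly (\<Prod>l=1..r. qpoch_num q (1 / A l) (n l + j + 1))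
           * (quotient_fps * fps_scale (q powi j) (tail_fps m n))
     = (fps_of_poly (\<Prod>l=1..r. qpoch_num q (1 / A l) (n l + j + 1)) * EA')
       * inverse EA * EB * inverse EB'"
    by (simp add: quotient_fps_def EA_def EB_def mult_ac)
  also have "\<dots> = fps_of_poly (\<Prod>l=1..r. qpoch_den q (1 / A l) (n l + j + 1))
       * (EA * inverse EA)
       * fps_of_poly (\<Prod>l=1..s. qpoch_num q (q / B l) (m l + j)) * (EB' * inverse EB')"
    unfolding 1 by (simp add: mult_ac flip: 2)
  also have "EA * inverse EA = 1" unfolding EA_def by (rule inverse_mult_eq_1') (simp add: c0)
  also have "EB' * inverse EB' = 1" unfolding EB'_def by (rule inverse_mult_eq_1') (simp add: c0)
  finally show ?thesis by (simp add: fps_of_poly_mult mult_ac)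
qed

lemma A_div_power_distinct: 
  assumes "i \<in> {1..r}" "l \<in> {1..r}" "l \<noteq> i"
  shows "A i / q ^ k \<noteq> A l / q ^ k'"
proof
  assume "A i / q ^ k = A l / q ^ k'"
  then have "A i / A l * q powi (int k' - int k) = 1"
    using q_nz A_nz[of l] by (simp add: power_int_diff field_simps)
  then show False using A_ratio[OF assms] by (simp add: off_q_lattice_def)
qed

lemma q_power_inj: "q ^ j = q ^ k \<Longrightarrow> j = k"
proof -
  assume "q ^ j = q ^ k"
  then have "cmod q ^ j = cmod q ^ k" by (metis norm_power)
  moreover have "0 < cmod q" using q_nz by simp
  ultimately show "j = k" using q_lt_1 power_inject_exp' [of "cmod q" j k] by auto
qed

text \<open>
  The inequality on \<open>j\<close> says that the rational function decays at infinity faster than \<open>1/x\<close>,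
  and \<open>m\<^sub>l + j \<ge> 0\<close> that its numerator contributes no poles. Hence the
  contributions of the points \<open>A\<^sub>i q\<^sup>-\<^sup>k\<close> add up to a Taylor coefficient. Factorials of negative index in the denominator
  move to the numerator polynomial.
\<close>

lemma sum_pole_terms:
  assumes m: "\<And>l. l \<in> {1..s} \<Longrightarrow> 0 \<le> m l + j"
    and deg: "(\<Sum>l=1..s. m l) - (\<Sum>l=1..r. n l) - int r - t + 1 < (int r - int s) * j"
  shows "(\<Sum>i=1..r. \<Sum>k<nat (j + n i + 1). pole_term m n t j i k)
         = (if t \<le> 0 then 0
            else fps_nth (quotient_fps * fps_scale (q powi j) (tail_fps m n)) (nat t - 1))"
proof -
  define e where "e l = nat (j + n l + 1)" for l
  define I where "I = (SIGMA i:{1..r}. {..<e i})"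
  define w where "w = (\<lambda>(i, k). A i / q ^ k :: complex)"
  define Z where "Z = w ` I"
  define D where "D = (\<Prod>l=1..r. qpoch_num q (1 / A l) (n l + j + 1))"
  define N1 where "N1 = (\<Prod>l=1..s. qpoch_num q (q / B l) (m l + j))"
  define N2 where "N2 = (\<Prod>l=1..r. qpoch_den q (1 / A l) (n l + j + 1))"
  have w_pair: "w (i, k) = A i / q ^ k" for i k by (simp add: w_def)
  have finI: "finite I" by (simp add: I_def)
  have inj: "inj_on w I"
  proof (rule inj_onI)
    fix x y assume "x \<in> I" "y \<in> I" "w x = w y"
    then obtain i k l k' where *: "x = (i, k)" "y = (l, k')" "i \<in> {1..r}" "l \<in> {1..r}"
      "A i / q ^ k = A l / q ^ k'"
      by (auto simp: I_def w_def)
    then have "l = i" using A_div_power_distinct by blast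
    moreover from this have "k = k'"
      using * A_nz[of i] q_nz q_power_inj[of k k'] by (simp add: field_simps)
    ultimately show "x = y" using * by simp
  qed
  have nzZ: "0 \<notin> Z" using A_nz q_nz by (auto simp: Z_def w_def)
  have finZ: "finite Z" using finI by (simp add: Z_def)
  have D_eq: "D = (\<Prod>z\<in>Z. [:1, - 1 / z:])"
  proof -
    have "(\<Prod>z\<in>Z. [:1, - 1 / z:]) = (\<Prod>x\<in>I. [:1, - 1 / w x:])"
      unfolding Z_def by (simp add: prod.reindex[OF inj])
    also have "\<dots> = (\<Prod>i=1..r. \<Prod>k<e i. [:1, - 1 / w (i, k):])"
      unfolding I_def by (subst prod.Sigma) (auto simp: case_prod_unfold)
    finally show ?thesis
      by (simp add: D_def qpoch_num_def w_def e_def add_ac)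
  qed
  have degN12: "int (degree (N1 * N2)) \<le> (\<Sum>l=1..s. m l + j) + (\<Sum>l=1..r. int (nat (- (n l + j + 1))))"
  proof -
    have N1: "degree N1 \<le> (\<Sum>l=1..s. nat (m l + j))"
    proof -
      have "degree N1 \<le> (\<Sum>l=1..s. degree (qpoch_num q (q / B l) (m l + j)))"
        unfolding N1_def using degree_prod_sum_le[of "{1..s}"] by (simp add: o_def)
      also have "\<dots> \<le> (\<Sum>l=1..s. nat (m l + j))"
      proof (rule sum_mono)
        fix l
        show "degree (qpoch_num q (q / B l) (m l + j)) \<le> nat (m l + j)"
          unfolding qpoch_num_def by (rule order.trans[OF degree_prod_linear_le]) simp
      qed
      finally show ?thesis .
    qed
    have N2: "degree N2 \<le> (\<Sum>l=1..r. nat (- (n l + j + 1)))"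
    proof -
      have "degree N2 \<le> (\<Sum>l=1..r. degree (qpoch_den q (1 / A l) (n l + j + 1)))"
        unfolding N2_def using degree_prod_sum_le[of "{1..r}"] by (simp add: o_def)
      also have "\<dots> \<le> (\<Sum>l=1..r. nat (- (n l + j + 1)))"
      proof (rule sum_mono)
        fix l
        show "degree (qpoch_den q (1 / A l) (n l + j + 1)) \<le> nat (- (n l + j + 1))"
          unfolding qpoch_den_def by (rule order.trans[OF degree_prod_linear_le]) simp
      qed
      finally show ?thesis .
    qed
    have "int (\<Sum>l=1..s. nat (m l + j)) = (\<Sum>l=1..s. m l + j)"
      unfolding of_nat_sum using m by (intro sum.cong) auto
    moreover have "int (degree (N1 * N2)) \<le> int (\<Sum>l=1..s. nat (m l + j))
        + int (\<Sum>l=1..r. nat (- (n l + j + 1)))"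
      using degree_mult_le[of N1 N2] N1 N2 by linarith
    ultimately show ?thesis by (simp only: of_nat_sum)
  qed
  have degN: "int (degree (N1 * N2)) + 2 \<le> int (card Z) + t"
  proof -
    have "(\<Sum>l=1..r. int (e l)) = int (card Z)"
      unfolding Z_def card_image[OF inj] by (simp add: I_def)
    moreover
    have "(\<Sum>l=1..r. int (e l)) - (\<Sum>l=1..r. int (nat (- (n l + j + 1)))) = (\<Sum>l=1..r. n l + j + 1)"
      unfolding sum_subtractf[symmetric] by (intro sum.cong) (auto simp: e_def)
    moreover have "(\<Sum>l=1..r. n l + j + 1) = (\<Sum>l=1..r. n l) + int r * j + int r"
      "(\<Sum>l=1..s. m l + j) = (\<Sum>l=1..s. m l) + int s * j"
      by (simp_all add: sum.distrib)
    moreover have "(int r - int s) * j = int r * j - int s * j" by (rule left_diff_distrib)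
    ultimately show ?thesis using deg degN12 by linarith
  qed
  have "(\<Sum>i=1..r. \<Sum>k<e i. pole_term m n t j i k) = (\<Sum>(i, k)\<in>I. pole_term m n t j i k)"
    unfolding I_def by (subst sum.Sigma) auto
  also have "\<dots> = (\<Sum>x\<in>I. w x powi (1 - t) * poly (N1 * N2) (w x) / (\<Prod>z\<in>Z - {w x}. 1 - w x / z))"
  proof (intro sum.cong refl)
    fix x assume x: "x \<in> I"
    obtain i k where ik: "x = (i, k)" "i \<in> {1..r}" "k < e i" using x by (auto simp: I_def)
    have wx: "w x = A i / q ^ k" by (simp add: ik w_pair)
    have "(\<Prod>z\<in>Z - {w x}. 1 - w x / z) = (\<Prod>y\<in>I - {x}. 1 - w x / w y)"
    proof -
      have "Z - {w x} = w ` (I - {x})" using inj x by (auto simp: Z_def inj_on_def)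
      then show ?thesis using prod.reindex[of w "I - {x}"] inj by (simp add: inj_on_diff)
    qed
    also have "I - {x} = (SIGMA i:{i}. {..<e i} - {k}) \<union> (SIGMA l:{1..r}-{i}. {..<e l})"
      using ik by (auto simp: I_def)
    also have "(\<Prod>y\<in>\<dots>. 1 - w x / w y) = (\<Prod>y\<in>(SIGMA i:{i}. {..<e i} - {k}). 1 - w x / w y)
        * (\<Prod>y\<in>(SIGMA l:{1..r}-{i}. {..<e l}). 1 - w x / w y)"
      by (rule prod.union_disjoint) auto
    also have "(\<Prod>y\<in>(SIGMA i:{i}. {..<e i} - {k}). 1 - w x / w y)
        = (\<Prod>i'\<in>{i}. \<Prod>k'\<in>{..<e i'} - {k}. 1 - w x / w (i', k'))"
      by (subst prod.Sigma) (auto simp: case_prod_unfold)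
    also have "\<dots> = (\<Prod>k'\<in>{..<e i} - {k}. 1 - q ^ k' / q ^ k)"
      using A_nz[of i] by (simp add: wx w_pair)
    also have "\<dots> = qpoch q (1 / q ^ k) (int k) * qpoch q q (int (e i - 1 - k))"
      by (rule prod_one_minus_q_powers_except[OF q_nz ik(3)])
    also have "int (e i - 1 - k) = j + n i - int k" using ik(3) by (simp add: e_def)
    also have "(\<Prod>y\<in>(SIGMA l:{1..r}-{i}. {..<e l}). 1 - w x / w y)
        = (\<Prod>l\<in>{1..r}-{i}. \<Prod>k'<e l. 1 - w x / w (l, k'))"
      by (subst prod.Sigma) (auto simp: case_prod_unfold)
    also have "\<dots> = (\<Prod>l\<in>{1..r}-{i}. poly (qpoch_num q (1 / A l) (n l + j + 1)) (w x))"
      by (simp add: w_pair qpoch_num_def poly_prod e_def add_ac mult_ac)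
    finally have den: "(\<Prod>z\<in>Z - {w x}. 1 - w x / z)
       = qpoch q (1 / q ^ k) (int k) * qpoch q q (j + n i - int k)
         * (\<Prod>l\<in>{1..r}-{i}. poly (qpoch_num q (1 / A l) (n l + j + 1)) (w x))" .
    have num: "poly N1 (w x) = (\<Prod>l=1..s. qpoch q (q * A i / B l / q ^ k) (m l + j))"
      unfolding N1_def poly_prod
    proof (intro prod.cong refl)
      fix l assume l: "l \<in> {1..s}"
      have "q * A i / B l / q ^ k = q / B l * w x" by (simp add: wx)
      then show "poly (qpoch_num q (q / B l) (m l + j)) (w x) = qpoch q (q * A i / B l / q ^ k) (m l + j)"
        using m[OF l] by (simp only: qpoch_eq_num_div_den) (simp add: qpoch_den_def)
    qed
    have "poly N2 (w x) = (\<Prod>l\<in>{1..r}-{i}. poly (qpoch_den q (1 / A l) (n l + j + 1)) (w x))"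
    proof -
      have "qpoch_den q (1 / A i) (n i + j + 1) = 1"
        using ik(3) by (simp add: qpoch_den_def e_def)
      then show ?thesis unfolding N2_def poly_prod
        using prod.remove[of "{1..r}" i "\<lambda>l. poly (qpoch_den q (1 / A l) (n l + j + 1)) (w x)"] ik(2)
        by simp
    qed
    moreover have "(\<Prod>l\<in>{1..r} - {i}. qpoch q (A i / A l / q ^ k) (n l + j + 1))
       = (\<Prod>l\<in>{1..r}-{i}. poly (qpoch_num q (1 / A l) (n l + j + 1)) (w x))
         / (\<Prod>l\<in>{1..r}-{i}. poly (qpoch_den q (1 / A l) (n l + j + 1)) (w x))"
      unfolding prod_dividef[symmetric]
    proof (intro prod.cong refl)
      fix l
      have "A i / A l / q ^ k = 1 / A l * w x" by (simp add: wx)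
      then show "qpoch q (A i / A l / q ^ k) (n l + j + 1) = poly (qpoch_num q (1 / A l) (n l + j + 1)) (w x)
          / poly (qpoch_den q (1 / A l) (n l + j + 1)) (w x)"
        by (simp only: qpoch_eq_num_div_den)
    qed
    ultimately show "(case x of (i, k) \<Rightarrow> pole_term m n t j i k)
        = w x powi (1 - t) * poly (N1 * N2) (w x) / (\<Prod>z\<in>Z - {w x}. 1 - w x / z)"
      unfolding den poly_mult num by (simp add: ik(1) pole_term_def wx[unfolded ik(1)])
  qed
  also have "\<dots> = (\<Sum>z\<in>Z. z powi (1 - t) * poly (N1 * N2) z / (\<Prod>y\<in>Z - {z}. 1 - z / y))"
    unfolding Z_def by (simp add: sum.reindex[OF inj])
  also have "\<dots> = (if t \<le> 0 then 0
      else fps_nth (quotient_fps * fps_scale (q powi j) (tail_fps m n)) (nat t - 1))"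
    using finite_quotient_fps[OF m]
    by (intro sum_over_poles_eq_coefficient[OF finZ nzZ D_eq degN]) (simp add: D_def N1_def N2_def)
  finally show ?thesis by (simp add: e_def)
qed

end

section \<open>The terminating series are sums over poles\<close>

lemma qpoch_nonzero:
  assumes "off_q_lattice q y" shows "qpoch q y n \<noteq> 0"
proof -
  have "1 - y * q powi k \<noteq> 0" for k using assms by (simp add: off_q_lattice_def)
  from this[of "int _"] this show ?thesis by (auto simp: qpoch_def)
qed

lemma one_minus_q_power_nonzero:
  fixes q :: complex
  assumes "cmod q < 1" shows "1 - q * q ^ k \<noteq> 0"
proof -
  have "cmod (q ^ Suc k) < 1" using assms by (simp add: norm_power power_less_one_iff del: power_Suc)
  then show ?thesis by auto
qed

lemma qpoch_q_nonzero:
  assumes "cmod q < 1" shows "qpoch q q (int n) \<noteq> 0"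
proof -
  from one_minus_q_power_nonzero[OF assms] show ?thesis by (simp add: qpoch_nat)
qed

lemma prod_power_int:
  fixes q :: complex
  assumes "q \<noteq> 0" shows "(\<Prod>l\<in>S. q powi f l) = q powi (\<Sum>l\<in>S. f l)"
  by (induction S rule: infinite_finite_induct) (simp_all add: assms power_int_add)

text \<open>
  This turns the factors belonging to the pole's own parameter into the upper parameter
  \<open>q\<^sup>-\<^sup>N\<close> and the factor \<open>(q; q)\<^sub>k\<close> of a terminating series. The exponents \<open>k (k + 1) / 2\<close> of
  the two reversals combine to \<open>k (k + 1)\<close>, which cancels against the \<open>k\<close>-th power of
  \<open>q\<^sup>k\<^sup>-\<^sup>N\<close> up to \<open>q\<^sup>k\<^sup>+\<^sup>N\<^sup>k\<close>.
\<close>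

lemma qpoch_terminating_pair:
  assumes q: "q \<noteq> 0" "cmod q < 1" and k: "k \<le> N"
  shows "1 / (qpoch q (1 / q ^ k) (int k) * qpoch q q (int N - int k))
       = q powi (int k + int N * int k) * qpoch q (q powi (- int N)) (int k)
         / (qpoch q q (int N) * qpoch q q (int k))"
proof -
  define T where "T = k * (k + 1) div 2"
  have T2: "int T * 2 = int k * (int k + 1)"
  proof -
    have "T * 2 = k * (k + 1)" by (simp add: T_def)
    then show ?thesis by (metis of_nat_mult of_nat_add of_nat_1 of_nat_numeral)
  qed
  define y where "y = q powi (int k - int N)"
  have y: "y \<noteq> 0" using q by (simp add: y_def)
  have yk: "y / q ^ k = q powi (- int N)"
    using q by (simp add: y_def power_int_diff power_int_minus field_simps)
  have 1: "qpoch q (1 / q ^ k) (int k) * q ^ T = (- 1) ^ k * qpoch q q (int k)"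
    using qpoch_base_divide_power[OF q(1), of 1 k] by (simp add: T_def)
  have 2: "qpoch q (q powi (- int N)) (int k) * q ^ T = (- y) ^ k * qpoch q (q / y) (int k)"
    using qpoch_base_divide_power[OF q(1) y, of k] by (simp add: T_def yk)
  have qy: "q / y = q * q ^ (N - k)"
    using q k by (simp add: y_def power_int_diff power_diff)
  have 3: "qpoch q q (int N) = qpoch q q (int (N - k)) * qpoch q (q / y) (int k)"
    using qpoch_nat_add[of q q "N - k" k] k by (simp add: qy)
  have nz: "qpoch q q (int N) \<noteq> 0" "qpoch q q (int k) \<noteq> 0" "qpoch q q (int (N - k)) \<noteq> 0"
    using qpoch_q_nonzero[OF q(2)] by auto
  have 4: "qpoch q (1 / q ^ k) (int k) = (- 1) ^ k * qpoch q q (int k) / q ^ T"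
    using 1 q by (simp add: field_simps)
  have 5: "qpoch q (q powi (- int N)) (int k) = (- y) ^ k * qpoch q (q / y) (int k) / q ^ T"
    using 2 q by (simp add: field_simps)
  have "q ^ T * q ^ T = q powi (int k + int N * int k) * y ^ k"
  proof -
    have "q ^ T * q ^ T = q powi int (T * 2)"
      unfolding power_int_of_nat by (simp only: power_mult power2_eq_square)
    also have "int (T * 2) = (int k + int N * int k) + (int k - int N) * int k"
      by (simp only: of_nat_mult of_nat_numeral T2) (simp add: algebra_simps)
    also have "q powi \<dots> = q powi (int k + int N * int k) * y ^ k"
      using q by (simp add: y_def power_int_add power_int_mult)
    finally show ?thesis .
  qed
  then have "q ^ T * (-1) ^ k = q powi (int k + int N * int k) * (- y) ^ k / q ^ T"
    using q by (simp add: field_simps power_minus[of y])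
  moreover have "1 / (qpoch q (1 / q ^ k) (int k) * qpoch q q (int (N - k)))
      = (q ^ T * (-1) ^ k) / (qpoch q q (int k) * qpoch q q (int (N - k)))"
    unfolding 4 using nz q by (simp add: field_simps flip: power_mult_distrib)
  ultimately show ?thesis using nz k unfolding 5 3 by (simp add: of_nat_diff)
qed

lemma qhyper_terminating:
  assumes "q \<noteq> 0"
  shows "qhyper q (q powi (- int L) # cs) ds z =
     (\<Sum>n\<le>L. (qpoch q (q powi (- int L)) (int n) * (\<Prod>c\<leftarrow>cs. qpoch q c (int n)))
          / ((\<Prod>d\<leftarrow>ds. qpoch q d (int n)) * qpoch q q (int n))
          * ((-1) ^ n * q ^ (n * (n - 1) div 2)) powi (int (length ds) - int (length cs)) * z ^ n)"
proof -
  have zero: "qpoch q (q powi (- int L)) (int n) = 0" if "n > L" for n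
  proof -
    have "1 - q powi (- int L) * q ^ L = 0" using assms by (simp add: power_int_minus)
    then show ?thesis using that unfolding qpoch_nat by (intro prod_zero) auto
  qed
  show ?thesis
    unfolding qhyper_def
    by (subst suminf_finite[of "{..L}"]) (auto simp: zero not_le)
qed

lemma qpow_add: "qpow lq (x + y) = qpow lq x * qpow lq y"
  by (simp add: qpow_def ring_distribs exp_add)

lemma qpow_diff: "qpow lq (x - y) = qpow lq x / qpow lq y"
  by (simp add: qpow_def left_diff_distrib exp_diff)

lemma qpow_nonzero [simp]: "qpow lq x \<noteq> 0"
  by (simp add: qpow_def)

lemma qpow_of_int: "qpow lq (of_int n) = exp lq powi n"
  by (simp add: qpow_def exp_power_int mult.commute)

lemma qpow_mult_of_int: "qpow lq (x * of_int n) = qpow lq x powi n"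
  by (simp add: qpow_def exp_power_int mult_ac)

lemma qpow_1: "qpow lq 1 = exp lq"
  by (simp add: qpow_def)

lemma prod_list_map_upt: "(\<Prod>x\<leftarrow>map f [1..<Suc s]. g x) = (\<Prod>l=1..s. g (f l))"
  using prod.distinct_set_conv_list[of "[1..<Suc s]" "\<lambda>l. g (f l)"]
  by (simp add: o_def atLeastLessThanSuc_atLeastAtMost del: upt_Suc)

lemma prod_list_map_others:
  "(\<Prod>x\<leftarrow>map f (others r i). g x) = (\<Prod>l\<in>{1..r} - {i}. g (f l))"
proof -
  have "set (others r i) = {1..r} - {i}" "distinct (others r i)"
    by (auto simp: others_def simp del: upt_Suc)
  then show ?thesis
    using prod.distinct_set_conv_list[of "others r i" "\<lambda>l. g (f l)"] by (simp add: o_def)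
qed

lemma length_others: "i \<in> {1..r} \<Longrightarrow> length (others r i) = r - 1"
proof -
  assume "i \<in> {1..r}"
  moreover have "set (others r i) = {1..r} - {i}" "distinct (others r i)"
    by (auto simp: others_def simp del: upt_Suc)
  ultimately show ?thesis using distinct_card[of "others r i"] by simp
qed

lemma cancel_shift_factor:
  fixes x y z z' v w :: complex
  assumes "x * y * z = v * w" "z * z' = 1" "y \<noteq> 0"
  shows "x = v * w / y * z'"
proof -
  have "x * y * (z * z') = v * w * z'" using assms(1) by (simp add: mult_ac)
  then show ?thesis using assms(2,3) by (simp add: field_simps)
qed

context q_product_quotient
begin

text \<open>
  Each factorial at \<open>A\<^sub>i q\<^sup>-\<^sup>k\<close> is moved to the base point \<open>A\<^sub>i\<close>; the powers of \<open>q\<close> picked up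
  on the way are exactly the \<open>k\<close>-th power of the argument of the series.
\<close>

lemma pole_term_eq_hyper_term:
  assumes i: "i \<in> {1..r}" and m: "\<And>l. l \<in> {1..s} \<Longrightarrow> 0 \<le> m l + j"
    and N: "j + n i = int N" and k: "k \<le> N"
    and nz: "\<And>l. l \<in> {1..s} \<Longrightarrow> qpoch q (B l / A i * q powi (- (m l + j))) (int k) \<noteq> 0"
  shows "pole_term m n t j i k =
     A i powi (1 - t) * (\<Prod>l=1..s. qpoch q (q * A i / B l) (m l + j))
     / (qpoch q q (j + n i) * (\<Prod>l\<in>{1..r} - {i}. qpoch q (A i / A l) (n l + j + 1)))
     * ((qpoch q (q powi (- int N)) (int k)
          * ((\<Prod>l=1..s. qpoch q (B l / A i) (int k))
             * (\<Prod>l\<in>{1..r} - {i}. qpoch q (A l / A i * q powi (- (n l + j))) (int k))))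
        / (((\<Prod>l=1..s. qpoch q (B l / A i * q powi (- (m l + j))) (int k))
             * (\<Prod>l\<in>{1..r} - {i}. qpoch q (q * A l / A i) (int k))) * qpoch q q (int k))
        * (q powi ((\<Sum>l=1..r. n l) - (\<Sum>l=1..s. m l) + int r - 1 + t + j * (int r - int s))) ^ k)"
proof -
  let ?k = "int k"
  have 1: "(A i / q ^ k) powi (1 - t) = A i powi (1 - t) * q powi ((t - 1) * ?k)"
  proof -
    have "(q ^ k) powi (1 - t) = q powi (?k * (1 - t))" using q_nz by (simp add: power_int_mult)
    moreover have "q powi ((t - 1) * ?k) * q powi (?k * (1 - t)) = 1"
      using q_nz by (simp add: algebra_simps flip: power_int_add)
    ultimately show ?thesis using q_nz by (simp add: power_int_divide_distrib field_simps)
  qed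
  have "qpoch q (q * A i / B l / q ^ k) (m l + j)
     = qpoch q (q * A i / B l) (m l + j) * qpoch q (B l / A i) ?k
       / qpoch q (B l / A i * q powi (- (m l + j))) ?k * q powi (- (m l + j) * ?k)"
    if l: "l \<in> {1..s}" for l
  proof -
    define e where "e = m l + j"
    have y: "q * A i / B l \<noteq> 0" using q_nz A_nz B_nz by simp
    have "q powi (1 - e) / (q * A i / B l) = B l / A i * q powi (- e)"
      using q_nz A_nz B_nz by (simp add: power_int_diff power_int_minus field_simps)
    moreover have "q / (q * A i / B l) = B l / A i" using q_nz by simp
    moreover have "q powi (e * ?k) * q powi (- e * ?k) = 1"
      using q_nz by (simp add: power_int_minus)
    ultimately show ?thesis
      using qpoch_shift_base[OF q_nz y, of e k] m[OF l] nz[OF l]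
      unfolding e_def[symmetric] by (intro cancel_shift_factor) simp_all
  qed
  then have 2: "(\<Prod>l=1..s. qpoch q (q * A i / B l / q ^ k) (m l + j))
     = (\<Prod>l=1..s. qpoch q (q * A i / B l) (m l + j)) * (\<Prod>l=1..s. qpoch q (B l / A i) ?k)
       / (\<Prod>l=1..s. qpoch q (B l / A i * q powi (- (m l + j))) ?k)
       * q powi (\<Sum>l=1..s. - (m l + j) * ?k)"
    unfolding prod.distrib[symmetric] prod_dividef[symmetric] prod_power_int[OF q_nz, symmetric]
    by (rule prod.cong[OF refl])
  have "1 / qpoch q (A i / A l / q ^ k) (n l + j + 1)
     = 1 / qpoch q (A i / A l) (n l + j + 1) * qpoch q (A l / A i * q powi (- (n l + j))) ?k
       / qpoch q (q * A l / A i) ?k * q powi ((n l + j + 1) * ?k)"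
    if l: "l \<in> {1..r} - {i}" for l
  proof -
    have y: "A i / A l \<noteq> 0" using A_nz by simp
    have off: "off_q_lattice q (A i / A l)" using A_ratio i l by auto
    have "q powi (1 - (n l + j + 1)) / (A i / A l) = A l / A i * q powi (- (n l + j))"
      using q_nz A_nz by (simp add: power_int_diff power_int_minus power_int_add field_simps)
    moreover have "q / (A i / A l) = q * A l / A i" by simp
    moreover have "qpoch q (q * A l / A i) ?k \<noteq> 0"
    proof -
      have "off_q_lattice q (A l / A i)" using A_ratio[of l i] i l by auto
      from qpoch_nonzero[OF this, of "int (1 + k)"] show ?thesis
        unfolding qpoch_nat_add by (simp add: mult_ac)
    qed
    moreover have "qpoch q (A i / A l) (n l + j + 1) \<noteq> 0" by (rule qpoch_nonzero[OF off])
    moreover have "qpoch q (A i / A l / q ^ k) (n l + j + 1) \<noteq> 0"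
      by (rule qpoch_nonzero[OF off_q_lattice_divide[OF q_nz off]])
    ultimately show ?thesis
      using qpoch_shift_base[OF q_nz y, of "n l + j + 1" k] off q_nz
      by (simp add: divide_simps mult_ac)
  qed
  then have "(\<Prod>l\<in>{1..r} - {i}. 1 / qpoch q (A i / A l / q ^ k) (n l + j + 1))
     = (\<Prod>l\<in>{1..r} - {i}. 1 / qpoch q (A i / A l) (n l + j + 1))
       * (\<Prod>l\<in>{1..r} - {i}. qpoch q (A l / A i * q powi (- (n l + j))) ?k)
       / (\<Prod>l\<in>{1..r} - {i}. qpoch q (q * A l / A i) ?k)
       * q powi (\<Sum>l\<in>{1..r} - {i}. (n l + j + 1) * ?k)"
    unfolding prod.distrib[symmetric] prod_dividef[symmetric] prod_power_int[OF q_nz, symmetric]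
    by (rule prod.cong[OF refl])
  then have 3: "1 / (\<Prod>l\<in>{1..r} - {i}. qpoch q (A i / A l / q ^ k) (n l + j + 1))
     = 1 / (\<Prod>l\<in>{1..r} - {i}. qpoch q (A i / A l) (n l + j + 1))
       * (\<Prod>l\<in>{1..r} - {i}. qpoch q (A l / A i * q powi (- (n l + j))) ?k)
       / (\<Prod>l\<in>{1..r} - {i}. qpoch q (q * A l / A i) ?k)
       * q powi (\<Sum>l\<in>{1..r} - {i}. (n l + j + 1) * ?k)"
    by (simp only: prod_dividef prod.neutral_const)
  note 4 = qpoch_terminating_pair[OF q_nz q_lt_1 k]
  define X where "X = (\<Sum>l=1..r. n l) - (\<Sum>l=1..s. m l) + int r - 1 + t + j * (int r - int s)"
  have S: "(\<Sum>l=1..r. n l) = n i + (\<Sum>l\<in>{1..r} - {i}. n l)"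
    using i by (intro sum.remove) auto
  have "X * ?k = (t - 1) * ?k + (\<Sum>l=1..s. - (m l + j) * ?k)
      + (\<Sum>l\<in>{1..r} - {i}. (n l + j + 1) * ?k) + (?k + int N * ?k)"
  proof -
    have "(\<Sum>l=1..s. - (m l + j) * ?k) = - ((\<Sum>l=1..s. m l) + int s * j) * ?k"
      unfolding sum_distrib_right[symmetric] sum_negf by (simp add: sum.distrib)
    moreover have "(\<Sum>l\<in>{1..r} - {i}. (n l + j + 1) * ?k)
        = ((\<Sum>l\<in>{1..r} - {i}. n l) + (int r - 1) * (j + 1)) * ?k"
      unfolding sum_distrib_right[symmetric] using i
      by (simp add: sum.distrib of_nat_diff algebra_simps)
    ultimately show ?thesis
      unfolding X_def S N[symmetric] by (simp only:) (simp add: algebra_simps)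
  qed
  moreover have "(q powi X) ^ k = q powi (X * ?k)" by (simp add: power_int_mult)
  ultimately have X: "(q powi X) ^ k = q powi ((t - 1) * ?k) * q powi (\<Sum>l=1..s. - (m l + j) * ?k)
      * q powi (\<Sum>l\<in>{1..r} - {i}. (n l + j + 1) * ?k) * q powi (?k + int N * ?k)"
    using q_nz by (simp only: power_int_add simp_thms)
  have "pole_term m n t j i k = (A i / q ^ k) powi (1 - t)
      * (\<Prod>l=1..s. qpoch q (q * A i / B l / q ^ k) (m l + j))
      * (1 / (qpoch q (1 / q ^ k) (int k) * qpoch q q (int N - int k)))
      * (1 / (\<Prod>l\<in>{1..r} - {i}. qpoch q (A i / A l / q ^ k) (n l + j + 1)))"
    unfolding pole_term_def N by simp
  then show ?thesis
    unfolding 1 2 3 4 X X_def[symmetric] N by (simp add: mult_ac)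
qed

end

text \<open>
  The zeros of \<open>(q\<^sup>-\<^sup>N; q)\<^sub>k\<close> for \<open>k > N = j + n\<^sub>i\<close> cut the series off at the last pole of
  index \<open>i\<close>; for \<open>j + n\<^sub>i < 0\<close> there is no such pole, in accordance with the value \<open>0\<close> of the
  term.
\<close>

lemma beta_term_eq_sum_pole_terms:
  fixes a b :: "nat \<Rightarrow> complex" and lq :: complex
  defines "A \<equiv> \<lambda>i. qpow lq (a i)" and "B \<equiv> \<lambda>l. qpow lq (b l)"
  assumes loc: "q_product_quotient q r s A B" and log_q: "exp lq = q"
    and i: "i \<in> {1..r}" and m: "\<And>l. l \<in> {1..s} \<Longrightarrow> 0 \<le> m l + j"
    and nz: "\<And>l N. l \<in> {1..s} \<Longrightarrow> int N \<le> j + n i \<Longrightarrow>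
               qpoch q (qpow lq (b l - a i - of_int (m l + j))) (int N) \<noteq> 0"
  shows "beta_term q lq r s a b m n t j i
       = (\<Sum>k<nat (j + n i + 1). q_product_quotient.pole_term q r s A B m n t j i k)"
proof (cases "j + n i < 0")
  case True
  then show ?thesis by (simp add: beta_term_def)
next
  case False
  then obtain N where N: "j + n i = int N" using nonneg_int_cases by (metis not_less)
  have q: "q \<noteq> 0" using log_q by auto
  have e: "qpow lq (1 - b l + a i) = q * A i / B l" "qpow lq (b l - a i) = B l / A i"
    "qpow lq (b l - a i - of_int (m l + j)) = B l / A i * q powi (- (m l + j))"
    "qpow lq (a i - a l) = A i / A l"
    "qpow lq (1 - a i + a l) = q * A l / A i"
    "qpow lq (a l - a i - of_int (n l + j)) = A l / A i * q powi (- (n l + j))" for l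
    by (simp_all only: qpow_add qpow_diff qpow_1 qpow_of_int log_q A_def B_def power_int_minus
        divide_inverse mult_ac)
  have e0: "qpow lq (a i * (1 - of_int t)) = A i powi (1 - t)"
    using qpow_mult_of_int[of lq "a i" "1 - t"] by (simp add: A_def)
  have N': "- j - n i = - int N" using N by simp
  have eN: "qpow lq (of_int (- int N)) = q powi (- int N)" by (simp only: qpow_of_int log_q)
  have len: "int (length (map f [1..<Suc s] @ map g (others r i)))
      - int (length (map f' [1..<Suc s] @ map g' (others r i))) = 0" for f g f' g' :: "nat \<Rightarrow> complex"
    by simp
  have "nat (j + n i + 1) = Suc N" using N by simp
  have "(\<Sum>k<nat (j + n i + 1). q_product_quotient.pole_term q r s A B m n t j i k)
      = (\<Sum>k\<le>N. q_product_quotient.pole_term q r s A B m n t j i k)"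
    by (simp only: \<open>nat (j + n i + 1) = Suc N\<close> lessThan_Suc_atMost)
  also have "\<dots> = beta_term q lq r s a b m n t j i"
    unfolding beta_term_def N' eN qhyper_terminating[OF q] len prod_list.append map_append
      prod_list_map_upt prod_list_map_others sum_distrib_left
    using False
  proof (simp only: if_False, intro sum.cong refl)
    fix k assume k: "k \<in> {..N}"
    show "q_product_quotient.pole_term q r s A B m n t j i k =
      qpow lq (a i * (1 - of_int t)) * (\<Prod>l=1..s. qpoch q (qpow lq (1 - b l + a i)) (m l + j))
        / (qpoch q q (j + n i)
           * (\<Prod>l\<in>{1..r} - {i}. qpoch q (qpow lq (a i - a l)) (n l + j + 1)))
      * (qpoch q (q powi - int N) (int k)
          * ((\<Prod>l=1..s. qpoch q (qpow lq (b l - a i)) (int k))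
             * (\<Prod>l\<in>{1..r} - {i}. qpoch q (qpow lq (a l - a i - of_int (n l + j))) (int k)))
        / ((\<Prod>l=1..s. qpoch q (qpow lq (b l - a i - of_int (m l + j))) (int k))
             * (\<Prod>l\<in>{1..r} - {i}. qpoch q (qpow lq (1 - a i + a l)) (int k)) * qpoch q q (int k))
        * ((- 1) ^ k * q ^ (k * (k - 1) div 2)) powi 0
        * (q powi ((\<Sum>l=1..r. n l) - (\<Sum>l=1..s. m l) + int r - 1 + t + j * (int r - int s))) ^ k)"
      unfolding e0 e
      using q_product_quotient.pole_term_eq_hyper_term
          [where m = m and n = n and j = j and k = k and t = t, OF loc i m N _ nz[unfolded e]] k N
      by (simp only: atMost_iff power_int_0_right mult_1_right mult.assoc)
  qed
  finally show ?thesis by simp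
qed

section \<open>The nonterminating series as a limit\<close>

lemma qpoch_tendsto_qpoch_inf:
  assumes "cmod q < 1"
  shows "(\<lambda>n. qpoch q a (int n)) \<longlonglongrightarrow> qpoch_inf q a"
    and "(\<And>k. 1 - a * q ^ k \<noteq> 0) \<Longrightarrow> qpoch_inf q a \<noteq> 0"
proof -
  have "summable (\<lambda>k. norm ((1 - a * q ^ k) - 1))"
    using assms by (simp add: norm_mult norm_power summable_mult summable_geometric)
  then have conv: "convergent_prod (\<lambda>k. 1 - a * q ^ k)"
    by (intro abs_convergent_prod_imp_convergent_prod) (simp add: abs_convergent_prod_conv_summable)
  then have "(\<lambda>n. \<Prod>k\<le>n. 1 - a * q ^ k) \<longlonglongrightarrow> prodinf (\<lambda>k. 1 - a * q ^ k)"
    by (rule convergent_prod_LIMSEQ)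
  then have "(\<lambda>n. \<Prod>k<Suc n. 1 - a * q ^ k) \<longlonglongrightarrow> prodinf (\<lambda>k. 1 - a * q ^ k)"
    by (simp only: lessThan_Suc_atMost)
  then have "(\<lambda>n. \<Prod>k<n. 1 - a * q ^ k) \<longlonglongrightarrow> prodinf (\<lambda>k. 1 - a * q ^ k)"
    by (rule LIMSEQ_offset[where k = 1, simplified])
  then have lim: "(\<lambda>n. qpoch q a (int n)) \<longlonglongrightarrow> prodinf (\<lambda>k. 1 - a * q ^ k)"
    by (simp only: qpoch_nat)
  then have eq: "qpoch_inf q a = prodinf (\<lambda>k. 1 - a * q ^ k)"
    unfolding qpoch_inf_def by (rule limI)
  show "(\<lambda>n. qpoch q a (int n)) \<longlonglongrightarrow> qpoch_inf q a" using lim eq by simp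
  show "qpoch_inf q a \<noteq> 0" if "\<And>k. 1 - a * q ^ k \<noteq> 0"
    unfolding eq using conv that by (rule prodinf_nonzero)
qed

lemma qpoch_inf_nonzero:
  assumes "cmod q < 1" "off_q_lattice q a" shows "qpoch_inf q a \<noteq> 0"
proof (rule qpoch_tendsto_qpoch_inf(2)[OF assms(1)])
  show "1 - a * q ^ k \<noteq> 0" for k
    using assms(2)[unfolded off_q_lattice_def, rule_format, of "int k"] by auto
qed

lemma qpoch_inf_q_nonzero:
  assumes "cmod q < 1" shows "qpoch_inf q q \<noteq> 0"
  by (rule qpoch_tendsto_qpoch_inf(2)[OF assms]) (rule one_minus_q_power_nonzero[OF assms])

text \<open>
  The quotient of successive terms contains a positive power of \<open>q\<^sup>n\<close>, so it tends to \<open>0\<close>.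
\<close>

lemma summable_qhyper:
  assumes q: "q \<noteq> 0" "cmod q < 1" and len: "length cs \<le> length ds"
  shows "summable (\<lambda>n. norm ((\<Prod>c\<leftarrow>cs. qpoch q c (int n)) / ((\<Prod>d\<leftarrow>ds. qpoch q d (int n)) * qpoch q q (int n))
          * ((-1) ^ n * q ^ (n * (n - 1) div 2)) powi (1 + int (length ds) - int (length cs))
          * z ^ n))"
proof -
  define e where "e = Suc (length ds - length cs)"
  have e: "1 + int (length ds) - int (length cs) = int e" using len by (simp add: e_def)
  define h where "h n = (\<Prod>c\<leftarrow>cs. qpoch q c (int n)) / ((\<Prod>d\<leftarrow>ds. qpoch q d (int n)) * qpoch q q (int n))
          * ((-1) ^ n * q ^ (n * (n - 1) div 2)) ^ e * z ^ n" for n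
  define \<rho> where "\<rho> n = (\<Prod>c\<leftarrow>cs. 1 - c * q ^ n) / ((\<Prod>d\<leftarrow>ds. 1 - d * q ^ n) * (1 - q * q ^ n))
          * (- (q ^ n)) ^ e * z" for n
  have prodS: "(\<Prod>c\<leftarrow>cs. qpoch q c (int (Suc n)))
      = (\<Prod>c\<leftarrow>cs. qpoch q c (int n)) * (\<Prod>c\<leftarrow>cs. 1 - c * q ^ n)" for cs n
    unfolding qpoch_nat_Suc by (induction cs) (simp_all add: mult_ac)
  have rec: "h (Suc n) = \<rho> n * h n" for n
  proof -
    have "Suc n * (Suc n - 1) div 2 = n * (n - 1) div 2 + n"
      by (cases n) auto
    then have eqn: "(-1) ^ Suc n * q ^ (Suc n * (Suc n - 1) div 2)
        = (- (q ^ n)) * ((-1) ^ n * q ^ (n * (n - 1) div 2))"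
      by (simp add: power_add)
    then show ?thesis
      unfolding h_def \<rho>_def prodS qpoch_nat_Suc[of q q] eqn power_mult_distrib
      by (simp add: mult_ac)
  qed
  have qn: "(\<lambda>n. q ^ n) \<longlonglongrightarrow> 0" using q by (intro LIMSEQ_power_zero)
  have lim1: "(\<lambda>n. \<Prod>c\<leftarrow>cs. 1 - c * q ^ n) \<longlonglongrightarrow> 1" for cs
  proof (induction cs)
    case (Cons c cs)
    have "(\<lambda>n. (1 - c * q ^ n) * (\<Prod>c\<leftarrow>cs. 1 - c * q ^ n)) \<longlonglongrightarrow> (1 - c * 0) * 1"
      by (intro tendsto_intros qn Cons.IH)
    then show ?case by simp
  qed simp
  have "\<rho> \<longlonglongrightarrow> 1 / (1 * (1 - q * 0)) * (- 0) ^ e * z"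
    unfolding \<rho>_def by (intro tendsto_intros lim1 qn) simp
  then have "\<rho> \<longlonglongrightarrow> 0" by (simp add: e_def)
  then have "eventually (\<lambda>n. norm (\<rho> n) < 1 / 2) sequentially"
    by (intro order_tendstoD[OF tendsto_norm_zero]) auto
  then obtain N where N: "\<And>n. n \<ge> N \<Longrightarrow> norm (\<rho> n) < 1 / 2"
    by (auto simp: eventually_sequentially)
  have "summable (\<lambda>n. norm (h n))"
  proof (rule summable_ratio_test[of "1 / 2" N])
    fix n assume "N \<le> n"
    then have "norm (\<rho> n) * norm (h n) \<le> 1 / 2 * norm (h n)"
      using N[of n] by (intro mult_right_mono) auto
    then show "norm (norm (h (Suc n))) \<le> 1 / 2 * norm (norm (h n))"
      by (simp add: rec norm_mult)
  qed simp
  then show ?thesis unfolding e power_int_of_nat h_def .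
qed

text \<open>
  Tannery's theorem, with the summable bound \<open>\<bar>U k\<bar>\<close> times a bound of the sequence \<open>V\<close>.
\<close>

lemma convolution_tendsto:
  fixes U V :: "nat \<Rightarrow> complex"
  assumes U: "summable (\<lambda>k. norm (U k))" and V: "V \<longlonglongrightarrow> v"
  shows "(\<lambda>J. \<Sum>k<Suc J. U k * V (J - k)) \<longlonglongrightarrow> suminf U * v"
proof -
  obtain C where C: "\<And>n. norm (V n) \<le> C"
    using convergent_imp_Bseq[of V] V by (auto simp: convergent_def Bseq_def)
  have C0: "0 \<le> C" using C[of 0] norm_ge_zero order_trans by blast
  define a where "a k J = (if k < Suc J then U k * V (J - k) else 0)" for k J
  have lim: "(\<lambda>J. a k J) \<longlonglongrightarrow> U k * v" for k
  proof -
    have "(\<lambda>J. U k * V J) \<longlonglongrightarrow> U k * v" by (intro tendsto_intros V)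
    then have "(\<lambda>J. a k (J + k)) \<longlonglongrightarrow> U k * v" by (simp add: a_def)
    then show ?thesis by (rule LIMSEQ_offset)
  qed
  have "((\<lambda>J. suminf (\<lambda>k. a k J)) \<longlonglongrightarrow> suminf (\<lambda>k. U k * v))"
  proof (rule tannerys_theorem[THEN conjunct2, THEN conjunct2])
    show "summable (\<lambda>k. norm (U k) * C)" by (rule summable_mult2[OF U])
    have "norm (a k J) \<le> norm (U k) * C" for k J
      using C[of "J - k"] C0 by (auto simp: a_def norm_mult intro!: mult_left_mono)
    then show "\<forall>\<^sub>F (k, J) in sequentially \<times>\<^sub>F sequentially. norm (a k J) \<le> norm (U k) * C"
      by (intro always_eventually) auto
  qed (use lim in auto)
  moreover have "suminf (\<lambda>k. a k J) = (\<Sum>k<Suc J. U k * V (J - k))" for J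
    by (subst suminf_finite[of "{..<Suc J}"]) (auto simp: a_def)
  moreover have "suminf (\<lambda>k. U k * v) = suminf U * v"
    by (rule suminf_mult2[symmetric]) (rule summable_norm_cancel[OF U])
  ultimately show ?thesis by simp
qed

lemma fps_mult_scale_nth:
  "fps_nth (f * fps_scale c g) n = (\<Sum>u\<le>n. fps_nth f (n - u) * fps_nth g u * c ^ u)"
proof -
  have "fps_nth (f * fps_scale c g) n = fps_nth (fps_scale c g * f) n" by (simp add: mult.commute)
  also have "\<dots> = (\<Sum>u\<le>n. fps_nth f (n - u) * fps_nth g u * c ^ u)"
    unfolding fps_mult_nth atLeast0AtMost by (intro sum.cong) (simp_all add: mult_ac)
  finally show ?thesis .
qed

context q_product_quotient
begin

lemma tail_fps_0: "fps_nth (tail_fps m n) 0 = 1"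
proof -
  have c0: "fps_nth (\<Prod>l\<in>I. fps_scale (c l) (euler_fps q)) 0 = 1" for I and c :: "nat \<Rightarrow> complex"
    by (induction I rule: infinite_finite_induct) simp_all
  show ?thesis unfolding tail_fps_def by (simp add: c0)
qed

text \<open>
  For \<open>m = n = 0\<close> the term is a product of a factor depending on \<open>k\<close> (the \<open>k\<close>-th term of the
  nonterminating series) and one depending on \<open>J - k\<close> that converges to a quotient of infinite
  products.
\<close>

lemma pole_term_zero_shifts:
  assumes i: "i \<in> {1..r}" and k: "k \<le> J"
    and z_def: "z = q powi (t + int r - 1) * (\<Prod>l=1..r. A l) * (\<Prod>l=1..s. 1 / B l)
                    * A i powi (int s - int r)"
  shows "pole_term (\<lambda>_. 0) (\<lambda>_. 0) t (int J) i k
     = A i powi (1 - t) * ((\<Prod>l=1..s. qpoch q (B l / A i) (int k))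
         / ((\<Prod>l\<in>{1..r} - {i}. qpoch q (q * A l / A i) (int k)) * qpoch q q (int k))
         * ((-1) ^ k * q ^ (k * (k - 1) div 2)) powi (int r - int s) * z ^ k)
       * ((\<Prod>l=1..s. qpoch q (q * A i / B l) (int (J - k)))
         / (qpoch q q (int (J - k)) * (\<Prod>l\<in>{1..r} - {i}. qpoch q (A i / A l) (int (Suc (J - k))))))"
proof -
  define c where "c = k * (k - 1) div 2"
  define T where "T = k * (k + 1) div 2"
  define e where "e = r - s"
  have re: "r = s + e" using s_less_r by (simp add: e_def)
  have Tc: "T = c + k"
    unfolding T_def c_def by (cases k) auto
  define Y where "Y = q ^ T"
  have Y: "Y \<noteq> 0" using q_nz by (simp add: Y_def)
  have 1: "(\<Prod>l=1..s. qpoch q (q * A i / B l / q ^ k) (int J))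
      = (\<Prod>l=1..s. (- (q * A i / B l))) ^ k / Y ^ s * (\<Prod>l=1..s. qpoch q (B l / A i) (int k))
        * (\<Prod>l=1..s. qpoch q (q * A i / B l) (int (J - k)))"
  proof -
    have "(\<Prod>l=1..s. qpoch q (q * A i / B l / q ^ k) (int J))
      = (\<Prod>l=1..s. (- (q * A i / B l)) ^ k / Y * qpoch q (B l / A i) (int k)
          * qpoch q (q * A i / B l) (int (J - k)))"
    proof (intro prod.cong refl)
      fix l
      have "q / (q * A i / B l) = B l / A i" using q_nz by simp
      then show "qpoch q (q * A i / B l / q ^ k) (int J) = (- (q * A i / B l)) ^ k / Y
          * qpoch q (B l / A i) (int k) * qpoch q (q * A i / B l) (int (J - k))"
        using qpoch_base_divide_power_ge[OF q_nz _ k, of "q * A i / B l"] q_nz A_nz B_nz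
        by (simp add: Y_def T_def)
    qed
    then show ?thesis by (simp only: prod.distrib prod_dividef prod_power_distrib prod_constant card_atLeastAtMost) simp
  qed
  have 2: "(\<Prod>l\<in>{1..r} - {i}. qpoch q (A i / A l / q ^ k) (int J + 1))
      = (\<Prod>l\<in>{1..r} - {i}. (- (A i / A l))) ^ k / Y ^ (r - 1)
        * (\<Prod>l\<in>{1..r} - {i}. qpoch q (q * A l / A i) (int k))
        * (\<Prod>l\<in>{1..r} - {i}. qpoch q (A i / A l) (int (Suc (J - k))))"
  proof -
    have "(\<Prod>l\<in>{1..r} - {i}. qpoch q (A i / A l / q ^ k) (int J + 1))
      = (\<Prod>l\<in>{1..r} - {i}. (- (A i / A l)) ^ k / Y * qpoch q (q * A l / A i) (int k)
          * qpoch q (A i / A l) (int (Suc (J - k))))"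
    proof (intro prod.cong refl)
      fix l
      have "int J + 1 = int (Suc J)" "Suc J - k = Suc (J - k)" using k by auto
      then show "qpoch q (A i / A l / q ^ k) (int J + 1) = (- (A i / A l)) ^ k / Y
          * qpoch q (q * A l / A i) (int k) * qpoch q (A i / A l) (int (Suc (J - k)))"
        using qpoch_base_divide_power_ge[OF q_nz _ le_SucI[OF k], of "A i / A l"] A_nz
        by (simp only:) (simp add: Y_def T_def)
    qed
    moreover have "card ({1..r} - {i}) = r - 1" using i by simp
    ultimately show ?thesis
      by (simp only: prod.distrib prod_dividef prod_power_distrib prod_constant)
  qed
  have 3: "qpoch q (1 / q ^ k) (int k) = (- 1) ^ k / Y * qpoch q q (int k)"
    using qpoch_base_divide_power[OF q_nz, of 1 k] Y by (simp add: Y_def T_def field_simps)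
  have 4: "(A i / q ^ k) powi (1 - t) = A i powi (1 - t) * (q powi (t - 1)) ^ k"
  proof -
    have "(q ^ k) powi (1 - t) = q powi (int k * (1 - t))" using q_nz by (simp add: power_int_mult)
    moreover have "(q powi (t - 1)) ^ k = q powi ((t - 1) * int k)" by (simp add: power_int_mult)
    moreover have "q powi ((t - 1) * int k) * q powi (int k * (1 - t)) = 1"
      using q_nz by (simp add: algebra_simps flip: power_int_add)
    ultimately show ?thesis using q_nz by (simp add: power_int_divide_distrib field_simps)
  qed
  define b where "b = (\<Prod>l=1..s. (- (q * A i / B l)))"
  define a where "a = (\<Prod>l\<in>{1..r} - {i}. (- (A i / A l)))"
  have a_nz: "a \<noteq> 0" unfolding a_def using A_nz by simp
  \<comment> \<open>the factors that are \<open>k\<close>-th powers: their bases agree up to sign\<close>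
  have base: "q powi (t - 1) * b * q ^ e = - a * (- 1) ^ e * z"
  proof -
    define PB where "PB = (\<Prod>l=1..s. B l)"
    define PA where "PA = (\<Prod>l\<in>{1..r} - {i}. A l)"
    have nz: "PB \<noteq> 0" "PA \<noteq> 0" using A_nz B_nz by (auto simp: PB_def PA_def)
    have b: "b = (- 1) ^ s * q ^ s * A i ^ s / PB"
      unfolding b_def PB_def minus_divide_left prod_dividef
      by (simp add: power_mult_distrib power_minus[of "q * A i"])
    have "card ({1..r} - {i}) = r - 1" using i by simp
    then have a: "a = (- A i) ^ (r - 1) / PA"
      unfolding a_def PA_def minus_divide_left prod_dividef by simp
    have PA: "(\<Prod>l=1..r. A l) = A i * PA"
      unfolding PA_def using i by (intro prod.remove) auto
    have z: "z = q powi (t + int r - 1) * (A i * PA) / PB / A i ^ e"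
    proof -
      have "int s - int r = - int e" using re by simp
      then show ?thesis
        unfolding z_def PA PB_def prod_dividef by (simp add: power_int_minus divide_inverse)
    qed
    have r1: "(- A i) ^ (r - 1) * A i = - ((- 1) ^ r * A i ^ r)"
    proof -
      have "(- A i) ^ (r - 1) * (- A i) = (- A i) ^ r"
        using s_less_r by (metis One_nat_def Suc_pred less_nat_zero_code neq0_conv power_Suc2)
      then show ?thesis using power_minus[of "A i" r] by (simp add: minus_equation_iff)
    qed
    have "- a * (- 1) ^ e * z = - ((- A i) ^ (r - 1) * A i) * (- 1) ^ e * q powi (t + int r - 1) / PB / A i ^ e"
      unfolding a z using nz by simp
    also have "\<dots> = ((- 1) ^ r * (- 1) ^ e) * (A i ^ r / A i ^ e) * q powi (t + int r - 1) / PB"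
      unfolding r1 by (simp add: mult_ac)
    also have "(- 1 :: complex) ^ r * (- 1) ^ e = (- 1) ^ s"
      by (simp add: re power_add flip: power_mult_distrib)
    also have "A i ^ r / A i ^ e = A i ^ s" using A_nz by (simp add: re power_add)
    also have "q powi (t + int r - 1) = q powi (t - 1) * q ^ s * q ^ e"
      unfolding re using q_nz by (simp add: power_int_add power_int_diff)
    finally show ?thesis unfolding b by (simp add: mult_ac)
  qed
  \<comment> \<open>the quadratic exponents: \<open>T = c + k\<close> leaves \<open>q\<^sup>c\<close> to the power \<open>r - s\<close>\<close>
  have key: "(q powi (t - 1)) ^ k * b ^ k * Y ^ r / Y ^ s
      = (- 1) ^ k * a ^ k * ((-1) ^ k * q ^ c) powi (int r - int s) * z ^ k"
  proof -
    have "Y ^ r / Y ^ s = Y ^ e" using Y by (simp add: re power_add)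
    also have "\<dots> = (q ^ c) ^ e * (q ^ e) ^ k"
      unfolding Y_def Tc by (simp add: power_add power_mult_distrib mult.commute flip: power_mult)
    finally have Y_quotient: "Y ^ r / Y ^ s = (q ^ c) ^ e * (q ^ e) ^ k" .
    have "(q powi (t - 1)) ^ k * b ^ k * Y ^ r / Y ^ s = (q powi (t - 1)) ^ k * b ^ k * (Y ^ r / Y ^ s)"
      by simp
    also have "\<dots> = (q powi (t - 1) * b * q ^ e) ^ k * (q ^ c) ^ e"
      unfolding Y_quotient by (simp add: power_mult_distrib mult_ac)
    also have "\<dots> = (- 1) ^ k * a ^ k * ((- 1) ^ e) ^ k * z ^ k * (q ^ c) ^ e"
      unfolding base power_mult_distrib power_minus[of a k] by simp
    also have "((- 1 :: complex) ^ e) ^ k = ((- 1) ^ k) ^ e" by (simp add: mult.commute flip: power_mult)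
    finally show ?thesis by (simp add: re power_mult_distrib mult_ac)
  qed
  have Yr: "Y ^ r = Y * Y ^ (r - 1)" using s_less_r by (cases r) auto
  have JK: "int J - int k = int (J - k)" using k by simp
  have "pole_term (\<lambda>_. 0) (\<lambda>_. 0) t (int J) i k
     = A i powi (1 - t) * ((q powi (t - 1)) ^ k * b ^ k * Y ^ r / Y ^ s) / ((- 1) ^ k * a ^ k)
       * ((\<Prod>l=1..s. qpoch q (B l / A i) (int k)) * (\<Prod>l=1..s. qpoch q (q * A i / B l) (int (J - k))))
       / (qpoch q q (int k) * qpoch q q (int (J - k))
          * (\<Prod>l\<in>{1..r} - {i}. qpoch q (q * A l / A i) (int k))
          * (\<Prod>l\<in>{1..r} - {i}. qpoch q (A i / A l) (int (Suc (J - k)))))"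
    unfolding pole_term_def add_0 add_0_right 1 2 3 4 b_def[symmetric] a_def[symmetric] JK Yr
    using Y by (simp add: mult_ac)
  also have "\<dots> = A i powi (1 - t) * (((-1) ^ k * q ^ c) powi (int r - int s) * z ^ k)
       * ((\<Prod>l=1..s. qpoch q (B l / A i) (int k)) * (\<Prod>l=1..s. qpoch q (q * A i / B l) (int (J - k))))
       / (qpoch q q (int k) * qpoch q q (int (J - k))
          * (\<Prod>l\<in>{1..r} - {i}. qpoch q (q * A l / A i) (int k))
          * (\<Prod>l\<in>{1..r} - {i}. qpoch q (A i / A l) (int (Suc (J - k)))))"
    unfolding key using a_nz by (simp add: mult.assoc)
  finally show ?thesis unfolding c_def by (simp add: mult_ac)
qed

text \<open>
  For large \<open>J\<close> the sum is the coefficient of \<open>P(x) Q(q\<^sup>J x)\<close>, and \<open>Q(q\<^sup>J x)\<close> tends to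
  \<open>Q(0) = 1\<close> coefficientwise.
\<close>

lemma sum_pole_terms_tendsto:
  "(\<lambda>J. \<Sum>i=1..r. \<Sum>k<Suc J. pole_term (\<lambda>_. 0) (\<lambda>_. 0) t (int J) i k)
     \<longlonglongrightarrow> (if t \<le> 0 then 0 else fps_nth quotient_fps (nat t - 1))"
proof -
  let ?c = "\<lambda>c. if t \<le> 0 then 0
    else fps_nth (quotient_fps * fps_scale c (tail_fps (\<lambda>_. 0) (\<lambda>_. 0))) (nat t - 1)"
  have "eventually (\<lambda>J. (\<Sum>i=1..r. \<Sum>k<Suc J. pole_term (\<lambda>_. 0) (\<lambda>_. 0) t (int J) i k) = ?c (q ^ J))
     sequentially"
    using eventually_ge_at_top[of "nat (2 - t)"]
  proof eventually_elim
    case (elim J)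
    have "(\<Sum>l=1..s. 0 :: int) - (\<Sum>l=1..r. 0) - int r - t + 1 < 1 * int J"
      using elim s_less_r by auto
    also have "\<dots> \<le> (int r - int s) * int J"
      using s_less_r by (intro mult_right_mono) auto
    finally show ?case
      using sum_pole_terms[of "\<lambda>_. 0" "int J" "\<lambda>_. 0" t] by (simp add: nat_add_distrib)
  qed
  moreover have "(\<lambda>J. ?c (q ^ J)) \<longlonglongrightarrow> (if t \<le> 0 then 0 else fps_nth quotient_fps (nat t - 1))"
  proof (cases "t \<le> 0")
    case False
    define n where "n = nat t - 1"
    have "(\<lambda>J. \<Sum>u\<le>n. fps_nth quotient_fps (n - u) * fps_nth (tail_fps (\<lambda>_. 0) (\<lambda>_. 0)) u * (q ^ J) ^ u)
      \<longlonglongrightarrow> (\<Sum>u\<le>n. fps_nth quotient_fps (n - u) * fps_nth (tail_fps (\<lambda>_. 0) (\<lambda>_. 0)) u * 0 ^ u)"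
      using q_lt_1 by (intro tendsto_intros LIMSEQ_power_zero)
    moreover have "(\<Sum>u\<le>n. fps_nth quotient_fps (n - u) * fps_nth (tail_fps (\<lambda>_. 0) (\<lambda>_. 0)) u * 0 ^ u)
      = (\<Sum>u\<in>{0}. fps_nth quotient_fps (n - u) * fps_nth (tail_fps (\<lambda>_. 0) (\<lambda>_. 0)) u * 0 ^ u)"
      by (intro sum.mono_neutral_right) auto
    ultimately show ?thesis using False by (simp add: fps_mult_scale_nth n_def tail_fps_0)
  qed simp
  ultimately show ?thesis by (simp add: tendsto_cong)
qed

text \<open>
  The partial fraction expansion of the quotient of infinite products, read off at one Taylor
  coefficient. It is the limit of the finite expansions, so no contour integral is needed.
\<close>

theorem sum_qhyper_eq_coefficient:
  "(\<Sum>i=1..r. A i powi (1 - t)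
      * ((\<Prod>l=1..s. qpoch_inf q (q * A i / B l)) / (\<Prod>l\<in>{1..r} - {i}. qpoch_inf q (A i / A l)))
      * qhyper q (map (\<lambda>l. B l / A i) [1..<Suc s]) (map (\<lambda>l. q * A l / A i) (others r i))
          (q powi (t + int r - 1) * (\<Prod>l=1..r. A l) * (\<Prod>l=1..s. 1 / B l) * A i powi (int s - int r)))
   = qpoch_inf q q * (if t \<le> 0 then 0 else fps_nth quotient_fps (nat t - 1))"
proof -
  define z where "z i = q powi (t + int r - 1) * (\<Prod>l=1..r. A l) * (\<Prod>l=1..s. 1 / B l)
      * A i powi (int s - int r)" for i
  define h where "h i k = (\<Prod>l=1..s. qpoch q (B l / A i) (int k))
         / ((\<Prod>l\<in>{1..r} - {i}. qpoch q (q * A l / A i) (int k)) * qpoch q q (int k))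
         * ((-1) ^ k * q ^ (k * (k - 1) div 2)) powi (int r - int s) * z i ^ k" for i k
  define V where "V i p = (\<Prod>l=1..s. qpoch q (q * A i / B l) (int p))
     / (qpoch q q (int p) * (\<Prod>l\<in>{1..r} - {i}. qpoch q (A i / A l) (int (Suc p))))" for i p
  define V' where "V' i = (\<Prod>l=1..s. qpoch_inf q (q * A i / B l))
     / (qpoch_inf q q * (\<Prod>l\<in>{1..r} - {i}. qpoch_inf q (A i / A l)))" for i
  let ?H = "\<lambda>i. qhyper q (map (\<lambda>l. B l / A i) [1..<Suc s]) (map (\<lambda>l. q * A l / A i) (others r i)) (z i)"
  have h: "(\<Prod>c\<leftarrow>map (\<lambda>l. B l / A i) [1..<Suc s]. qpoch q c (int n))
        / ((\<Prod>d\<leftarrow>map (\<lambda>l. q * A l / A i) (others r i). qpoch q d (int n)) * qpoch q q (int n))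
        * ((-1) ^ n * q ^ (n * (n - 1) div 2))
            powi (1 + int (length (map (\<lambda>l. q * A l / A i) (others r i)))
              - int (length (map (\<lambda>l. B l / A i) [1..<Suc s])))
        * z i ^ n = h i n" if "i \<in> {1..r}" for i n
  proof -
    have "1 + int (length (map (\<lambda>l. q * A l / A i) (others r i)))
        - int (length (map (\<lambda>l. B l / A i) [1..<Suc s])) = int r - int s"
      using length_others[OF that] s_less_r by simp
    then show ?thesis unfolding h_def by (simp only: prod_list_map_upt prod_list_map_others)
  qed
  have H: "?H i = suminf (h i)" if "i \<in> {1..r}" for i
    unfolding qhyper_def h[OF that] ..
  have summ: "summable (\<lambda>k. norm (A i powi (1 - t) * h i k))" if "i \<in> {1..r}" for i
  proof -
    have "length (map (\<lambda>l. B l / A i) [1..<Suc s]) \<le> length (map (\<lambda>l. q * A l / A i) (others r i))"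
      using length_others[OF that] s_less_r by (simp del: upt_Suc)
    from summable_qhyper[OF q_nz q_lt_1 this, of "z i"] have "summable (\<lambda>k. norm (h i k))"
      unfolding h[OF that] .
    then show ?thesis by (simp add: norm_mult summable_mult)
  qed
  have V: "V i \<longlonglongrightarrow> V' i" if i: "i \<in> {1..r}" for i
    unfolding V_def V'_def
  proof (intro tendsto_divide tendsto_mult tendsto_prod qpoch_tendsto_qpoch_inf(1) q_lt_1)
    fix l
    show "(\<lambda>p. qpoch q (A i / A l) (int (Suc p))) \<longlonglongrightarrow> qpoch_inf q (A i / A l)"
      by (rule LIMSEQ_Suc) (rule qpoch_tendsto_qpoch_inf(1)[OF q_lt_1])
  next
    have "qpoch_inf q (A i / A l) \<noteq> 0" if "l \<in> {1..r} - {i}" for l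
      using qpoch_inf_nonzero[OF q_lt_1 A_ratio[of i l]] i that by auto
    then show "qpoch_inf q q * (\<Prod>l\<in>{1..r} - {i}. qpoch_inf q (A i / A l)) \<noteq> 0"
      using qpoch_inf_q_nonzero[OF q_lt_1] by simp
  qed
  have "(\<lambda>J. \<Sum>i=1..r. \<Sum>k<Suc J. A i powi (1 - t) * h i k * V i (J - k))
      \<longlonglongrightarrow> (\<Sum>i=1..r. suminf (\<lambda>k. A i powi (1 - t) * h i k) * V' i)"
    by (intro tendsto_sum convolution_tendsto summ V)
  moreover have "(\<Sum>i=1..r. \<Sum>k<Suc J. A i powi (1 - t) * h i k * V i (J - k))
      = (\<Sum>i=1..r. \<Sum>k<Suc J. pole_term (\<lambda>_. 0) (\<lambda>_. 0) t (int J) i k)" for J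
    unfolding h_def V_def
    by (intro sum.cong refl, subst pole_term_zero_shifts[OF _ _ z_def]) (simp_all add: mult.assoc)
  ultimately have "(\<Sum>i=1..r. suminf (\<lambda>k. A i powi (1 - t) * h i k) * V' i)
      = (if t \<le> 0 then 0 else fps_nth quotient_fps (nat t - 1))"
    using sum_pole_terms_tendsto[of t] by (auto intro: LIMSEQ_unique)
  moreover have "suminf (\<lambda>k. A i powi (1 - t) * h i k) = A i powi (1 - t) * ?H i"
    if "i \<in> {1..r}" for i
  proof -
    have "summable (h i)"
      using summable_norm_cancel[OF summ[OF that]] A_nz[of i] by (simp add: summable_mult_D)
    then show ?thesis unfolding H[OF that] by (rule suminf_mult)
  qed
  ultimately have "(\<Sum>i=1..r. A i powi (1 - t) * ?H i * V' i)
      = (if t \<le> 0 then 0 else fps_nth quotient_fps (nat t - 1))" by simp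
  moreover have "(\<Sum>i=1..r. A i powi (1 - t)
      * ((\<Prod>l=1..s. qpoch_inf q (q * A i / B l)) / (\<Prod>l\<in>{1..r} - {i}. qpoch_inf q (A i / A l)))
      * ?H i) = qpoch_inf q q * (\<Sum>i=1..r. A i powi (1 - t) * ?H i * V' i)"
    unfolding sum_distrib_left V'_def
    using qpoch_inf_q_nonzero[OF q_lt_1] by (intro sum.cong) (simp_all add: mult_ac)
  ultimately show ?thesis unfolding z_def by simp
qed

end

section \<open>Summation with Gaussian binomial weights\<close>

text \<open>
  The coefficient of \<open>y\<^sup>d\<close> in \<open>(y; q)\<^sub>T\<close>.
\<close>

definition signed_qbinom :: "complex \<Rightarrow> nat \<Rightarrow> nat \<Rightarrow> complex" where
  "signed_qbinom q T d = qbinom q (int T) (int d) * q ^ (d * (d - 1) div 2) * (-1) ^ d"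

lemma signed_qbinom_0: "cmod q < 1 \<Longrightarrow> signed_qbinom q T 0 = 1"
  using qpoch_q_nonzero[of q T] by (simp add: signed_qbinom_def qbinom_def)

lemma signed_qbinom_eq_0: "d > T \<Longrightarrow> signed_qbinom q T d = 0"
  by (simp add: signed_qbinom_def qbinom_def)

text \<open>
  Comparing coefficients in \<open>(y; q)\<^sub>T\<^sub>+\<^sub>1 = (1 - y) (q y; q)\<^sub>T\<close> gives this form of the Pascal
  recursion.
\<close>

lemma signed_qbinom_pascal:
  assumes q: "cmod q < 1"
  shows "signed_qbinom q (Suc T) (Suc d)
       = q ^ Suc d * signed_qbinom q T (Suc d) - q ^ d * signed_qbinom q T d"
proof -
  let ?Q = "\<lambda>n. qpoch q q (int n)"
  have nz: "?Q n \<noteq> 0" for n by (rule qpoch_q_nonzero[OF q])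
  have pascal: "qbinom q (int (Suc T)) (int (Suc d))
      = q ^ Suc d * qbinom q (int T) (int (Suc d)) + qbinom q (int T) (int d)"
  proof (cases d T rule: linorder_cases)
    case less
    define p where "p = T - Suc d"
    have T: "T = Suc (d + p)" using less by (simp add: p_def)
    have S: "?Q (Suc n) = ?Q n * (1 - q ^ Suc n)" for n unfolding qpoch_nat_Suc by simp
    have nz': "1 - q ^ Suc n \<noteq> 0" for n using nz[of "Suc n"] unfolding S by simp
    have b1: "qbinom q (int (Suc T)) (int (Suc d)) = ?Q (Suc T) / (?Q (Suc d) * ?Q (Suc p))"
      by (simp add: qbinom_def T flip: of_nat_diff)
    have b2: "qbinom q (int T) (int (Suc d)) = ?Q T / (?Q (Suc d) * ?Q p)"
      by (simp add: qbinom_def T flip: of_nat_diff)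
    have b3: "qbinom q (int T) (int d) = ?Q T / (?Q d * ?Q (Suc p))"
      by (simp add: qbinom_def T flip: of_nat_diff)
    have "q ^ Suc T = q ^ Suc d * q ^ Suc p" by (simp add: T power_add)
    then have split: "1 - q ^ Suc T = q ^ Suc d * (1 - q ^ Suc p) + (1 - q ^ Suc d)"
      by (simp add: right_diff_distrib del: power_Suc)
    define x y where "x = 1 - q ^ Suc d" and "y = 1 - q ^ Suc p"
    have "x \<noteq> 0" "y \<noteq> 0" unfolding x_def y_def by (rule nz')+
    then show ?thesis
      unfolding b1 b2 b3 S split x_def[symmetric] y_def[symmetric] using nz[of d] nz[of p]
      by (simp add: divide_simps del: power_Suc) (simp add: algebra_simps del: power_Suc)
  next
    case equal
    then show ?thesis using nz[of T] nz[of "Suc T"] by (simp add: qbinom_def)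
  next
    case greater
    then show ?thesis by (simp add: qbinom_def)
  qed
  have e: "Suc d * (Suc d - 1) div 2 = d * (d - 1) div 2 + d" by (cases d) auto
  show ?thesis unfolding signed_qbinom_def pascal e by (simp add: power_add algebra_simps)
qed

lemma qpoch_eq_sum_signed_qbinom:
  assumes q: "cmod q < 1"
  shows "qpoch q y (int T) = (\<Sum>d\<le>T. signed_qbinom q T d * y ^ d)"
proof (induction T arbitrary: y)
  case 0
  then show ?case using signed_qbinom_0[OF q, of 0] by simp
next
  case (Suc T)
  let ?w = "signed_qbinom q"
  have "(\<Sum>d\<le>Suc T. ?w (Suc T) d * y ^ d) = 1 + (\<Sum>d\<le>T. ?w (Suc T) (Suc d) * y ^ Suc d)"
    by (simp add: sum.atMost_Suc_shift signed_qbinom_0[OF q] del: sum.atMost_Suc)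
  also have "\<dots> = (1 + (\<Sum>d\<le>T. ?w T (Suc d) * (q * y) ^ Suc d)) - y * (\<Sum>d\<le>T. ?w T d * (q * y) ^ d)"
    by (simp add: signed_qbinom_pascal[OF q] sum_distrib_left power_mult_distrib algebra_simps
        sum_subtractf)
  also have "1 + (\<Sum>d\<le>T. ?w T (Suc d) * (q * y) ^ Suc d) = (\<Sum>d\<le>Suc T. ?w T d * (q * y) ^ d)"
    by (simp add: sum.atMost_Suc_shift signed_qbinom_0[OF q] del: sum.atMost_Suc)
  also have "\<dots> = (\<Sum>d\<le>T. ?w T d * (q * y) ^ d)" by (simp add: signed_qbinom_eq_0)
  finally have "(\<Sum>d\<le>Suc T. ?w (Suc T) d * y ^ d) = (1 - y) * qpoch q (q * y) (int T)"
    unfolding Suc.IH by (simp add: algebra_simps)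
  also have "\<dots> = qpoch q y (int (Suc T))"
    using qpoch_nat_add[of q y 1 T] by (simp add: qpoch_def mult.commute)
  finally show ?case by simp
qed

text \<open>
  Since \<open>(y; q)\<^sub>T\<^sub>+\<^sub>1\<close> contains the factor \<open>1 - y\<close>, the convolution with its coefficients is the
  backward difference of the convolution with the coefficients of \<open>(q y; q)\<^sub>T\<close>. The sum
  telescopes, and its lower end vanishes with \<open>\<gamma>\<close>.
\<close>

lemma sum_signed_qbinom_convolution:
  fixes \<gamma> :: "int \<Rightarrow> complex"
  assumes q: "q \<noteq> 0" "cmod q < 1" and \<gamma>: "\<And>j. j < lo \<Longrightarrow> \<gamma> j = 0"
  shows "(\<Sum>k=lo..K. \<Sum>d\<le>Suc T. signed_qbinom q (Suc T) d * \<gamma> (k - int d))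
       = (\<Sum>d\<le>T. q ^ d * signed_qbinom q T d * \<gamma> (K - int d))"
proof -
  let ?w = "signed_qbinom q"
  define \<delta> where "\<delta> k = (\<Sum>d\<le>T. q ^ d * ?w T d * \<gamma> (k - int d))" for k
  have diff: "(\<Sum>d\<le>Suc T. ?w (Suc T) d * \<gamma> (k - int d)) = \<delta> k - \<delta> (k - 1)" for k
  proof -
    have "(\<Sum>d\<le>Suc T. ?w (Suc T) d * \<gamma> (k - int d))
        = \<gamma> k + (\<Sum>d\<le>T. ?w (Suc T) (Suc d) * \<gamma> (k - int (Suc d)))"
      by (simp add: sum.atMost_Suc_shift signed_qbinom_0[OF q(2)] del: sum.atMost_Suc)
    also have "\<dots> = (\<gamma> k + (\<Sum>d\<le>T. q ^ Suc d * ?w T (Suc d) * \<gamma> (k - int (Suc d))))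
        - (\<Sum>d\<le>T. q ^ d * ?w T d * \<gamma> (k - 1 - int d))"
      by (simp add: signed_qbinom_pascal[OF q(2)] algebra_simps sum_subtractf)
    also have "\<gamma> k + (\<Sum>d\<le>T. q ^ Suc d * ?w T (Suc d) * \<gamma> (k - int (Suc d)))
        = (\<Sum>d\<le>Suc T. q ^ d * ?w T d * \<gamma> (k - int d))"
      by (simp add: sum.atMost_Suc_shift signed_qbinom_0[OF q(2)] del: sum.atMost_Suc)
    also have "\<dots> = (\<Sum>d\<le>T. q ^ d * ?w T d * \<gamma> (k - int d))" by (simp add: signed_qbinom_eq_0)
    finally show ?thesis unfolding \<delta>_def .
  qed
  have low: "\<delta> k = 0" if "k < lo" for k
    unfolding \<delta>_def using that \<gamma> by (intro sum.neutral) auto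
  have "(\<Sum>k=lo..K. \<delta> k - \<delta> (k - 1)) = \<delta> K"
  proof (cases "lo \<le> K + 1")
    case True
    define n where "n = nat (K + 1 - lo)"
    have K: "K = lo + int n - 1" using True by (simp add: n_def)
    have "(\<Sum>k=lo..lo + int n - 1. \<delta> k - \<delta> (k - 1)) = \<delta> (lo + int n - 1)"
    proof (induction n)
      case 0
      then show ?case by (simp add: low)
    next
      case (Suc n)
      have "{lo..lo + int (Suc n) - 1} = insert (lo + int n) {lo..lo + int n - 1}" by auto
      then show ?case using Suc.IH by simp
    qed
    then show ?thesis unfolding K .
  qed (simp add: low)
  then show ?thesis unfolding diff unfolding \<delta>_def .
qed

lemma qpoch_inf_eq_0:
  assumes "cmod q < 1" and "1 - a * q ^ k = 0" shows "qpoch_inf q a = 0"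
proof -
  have "eventually (\<lambda>n. qpoch q a (int n) = 0) sequentially"
    using eventually_gt_at_top[of k]
  proof eventually_elim
    case (elim n)
    then show ?case unfolding qpoch_nat using assms(2) by (intro prod_zero) auto
  qed
  then have "(\<lambda>n. qpoch q a (int n)) \<longlonglongrightarrow> 0" by (rule tendsto_eventually)
  then show ?thesis using qpoch_tendsto_qpoch_inf(1)[OF assms(1)] LIMSEQ_unique by blast
qed

lemma qpoch_inf_split:
  assumes "cmod q < 1"
  shows "qpoch_inf q a = qpoch q a (int T) * qpoch_inf q (a * q ^ T)"
proof -
  have "(\<lambda>n. qpoch q a (int (n + T))) \<longlonglongrightarrow> qpoch_inf q a"
    by (rule LIMSEQ_ignore_initial_segment) (rule qpoch_tendsto_qpoch_inf(1)[OF assms])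
  moreover have "(\<lambda>n. qpoch q a (int (n + T))) \<longlonglongrightarrow> qpoch q a (int T) * qpoch_inf q (a * q ^ T)"
    unfolding add.commute[of _ T] qpoch_nat_add
    by (intro tendsto_intros qpoch_tendsto_qpoch_inf(1) assms)
  ultimately show ?thesis by (rule LIMSEQ_unique)
qed

lemma qpoch_negative_power_eq_0:
  assumes "q \<noteq> 0" "1 \<le> u" "u \<le> T" shows "qpoch q (q / q ^ u) (int T) = 0"
proof -
  have "1 - q / q ^ u * q ^ (u - 1) = 0"
    using assms by (cases u) auto
  then show ?thesis unfolding qpoch_nat using assms by (intro prod_zero) (auto intro!: bexI[of _ "u - 1"])
qed

text \<open>
  The lower limit of the sum defining \<open>\<beta>\<^sub>k\<close> only discards indices \<open>j < -n\<^sub>m\<^sub>a\<^sub>x\<close>, where every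
  term is \<open>0\<close>; so \<open>\<beta>\<close> is a full convolution of \<open>\<gamma>\<close> with the coefficients of \<open>(y; q)\<^sub>t\<close>.
\<close>

lemma beta_eq_signed_qbinom_convolution:
  assumes "t = int (Suc T)"
    and \<gamma>_def: "\<And>j. \<gamma> j = (\<Sum>i=1..r. beta_term q lq r s a b m n t j i)"
  shows "\<And>j. j < - n_max r n \<Longrightarrow> \<gamma> j = 0"
    and "k \<ge> - n_max r n \<Longrightarrow> beta q lq r s a b m n t k = (\<Sum>d\<le>Suc T. signed_qbinom q (Suc T) d * \<gamma> (k - int d))"
proof -
  show \<gamma>0: "\<gamma> j = 0" if "j < - n_max r n" for j
  proof -
    have "n i \<le> n_max r n" if "i \<in> {1..r}" for i
      unfolding n_max_def using that by (intro Max_ge) auto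
    then show ?thesis using that unfolding \<gamma>_def by (intro sum.neutral) (force simp: beta_term_def)
  qed
  let ?g = "\<lambda>j. qbinom q (max 0 t) (k - j) * q powi ((k - j) * (k - j - 1) div 2) * (-1) powi (k - j) * \<gamma> j"
  have "beta q lq r s a b m n t k = (\<Sum>j=max (- n_max r n) (k - max 0 t)..k. ?g j)"
    unfolding beta_def \<gamma>_def ..
  also have "\<dots> = (\<Sum>j=k - int (Suc T)..k. ?g j)"
    using assms(1) by (intro sum.mono_neutral_left) (auto simp: \<gamma>0)
  also have "\<dots> = (\<Sum>d\<le>Suc T. signed_qbinom q (Suc T) d * \<gamma> (k - int d))"
  proof (rule sum.reindex_bij_witness[of _ "\<lambda>d. k - int d" "\<lambda>j. nat (k - j)"])
    fix j assume j: "j \<in> {k - int (Suc T)..k}"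
    define d where "d = nat (k - j)"
    have d: "k - j = int d" and jd: "k - int d = j" using j by (auto simp: d_def)
    have "int d * (int d - 1) = int (d * (d - 1))" by (cases d) (auto simp: algebra_simps)
    then have e: "int d * (int d - 1) div 2 = int (d * (d - 1) div 2)"
      by (simp only: zdiv_int of_nat_numeral)
    show "signed_qbinom q (Suc T) (nat (k - j)) * \<gamma> (k - int (nat (k - j))) = ?g j"
      unfolding d_def[symmetric] d jd e signed_qbinom_def assms(1) by (simp add: jd)
  qed auto
  finally show "beta q lq r s a b m n t k = (\<Sum>d\<le>Suc T. signed_qbinom q (Suc T) d * \<gamma> (k - int d))" .
qed

section \<open>The identity\<close>

text \<open>
  For \<open>t > 0\<close> both sides equal \<open>(q; q)\<^sub>\<infinity>\<close> times the coefficient of \<open>x\<^sup>t\<^sup>-\<^sup>1\<close> in \<open>quotient_fps\<close>.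
  On the right, write \<open>T = t - 1\<close>. The convolution leaves only the inner sums with index \<open>j\<close>
  between \<open>K - T\<close> and \<open>K\<close>, and \<open>K\<close> is chosen so that for these \<open>j\<close> they are given by
  \<open>sum_pole_terms\<close>, that is, by a polynomial of degree at most \<open>T\<close> in \<open>q\<^sup>j\<close>.
  The weights send the monomial of degree \<open>u\<close> to a multiple of \<open>(q\<^sup>1\<^sup>-\<^sup>u; q)\<^sub>T\<close>, which is \<open>0\<close>
  for \<open>1 \<le> u \<le> T\<close>; the constant term remains.
\<close>

theorem proposition3:
  fixes q lq :: complex and r s :: nat
    and a b :: "nat \<Rightarrow> complex" and m n :: "nat \<Rightarrow> int" and t :: int
  assumes q: "0 < cmod q" "cmod q < 1" and log_q: "exp lq = q"
    and rs: "s < r"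
    and a_diff: "\<And>i j. 1 \<le> i \<Longrightarrow> i < j \<Longrightarrow> j \<le> r \<Longrightarrow> a i - a j \<notin> \<int>"
    \<comment> \<open>no vanishing denominators on the left-hand side\<close>
    and lhs_factor_nz: "\<And>i l. i \<in> {1..r} \<Longrightarrow> l \<in> {1..r} \<Longrightarrow> l \<noteq> i \<Longrightarrow>
          qpoch_inf q (qpow lq (a i - a l)) \<noteq> 0"
    and lhs_series_nz: "\<And>i l N. i \<in> {1..r} \<Longrightarrow> l \<in> {1..r} \<Longrightarrow> l \<noteq> i \<Longrightarrow>
          qpoch q (qpow lq (1 + a l - a i)) (int N) \<noteq> 0"
    \<comment> \<open>no vanishing denominators in the terms of the right-hand side with \<open>j + n\<^sub>i \<ge> 0\<close>;
      their series are sums over \<open>0 \<le> N \<le> j + n\<^sub>i\<close>\<close>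
    and rhs_num_defined: "\<And>i j l. i \<in> {1..r} \<Longrightarrow> j \<in> {- n_max r n..K_bound r s m n t} \<Longrightarrow>
          0 \<le> j + n i \<Longrightarrow> l \<in> {1..s} \<Longrightarrow>
          qpoch_defined q (qpow lq (1 - b l + a i)) (m l + j)"
    and rhs_factor_nz: "\<And>i j l. i \<in> {1..r} \<Longrightarrow> j \<in> {- n_max r n..K_bound r s m n t} \<Longrightarrow>
          0 \<le> j + n i \<Longrightarrow> l \<in> {1..r} \<Longrightarrow> l \<noteq> i \<Longrightarrow>
          qpoch_defined q (qpow lq (a i - a l)) (n l + j + 1) \<and>
          qpoch q (qpow lq (a i - a l)) (n l + j + 1) \<noteq> 0"
    and rhs_series_nz: "\<And>i j l N. i \<in> {1..r} \<Longrightarrow> j \<in> {- n_max r n..K_bound r s m n t} \<Longrightarrow>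
          0 \<le> j + n i \<Longrightarrow> l \<in> {1..s} \<Longrightarrow> int N \<le> j + n i \<Longrightarrow>
          qpoch q (qpow lq (b l - a i - of_int (m l + j))) (int N) \<noteq> 0"
  shows "(\<Sum>i=1..r.
            qpow lq (a i * (1 - of_int t))
            * ((\<Prod>l=1..s. qpoch_inf q (qpow lq (1 - b l + a i)))
               / (\<Prod>l\<in>{1..r} - {i}. qpoch_inf q (qpow lq (a i - a l))))
            * qhyper q
                (map (\<lambda>l. qpow lq (b l - a i)) [1..<Suc s])
                (map (\<lambda>l. qpow lq (1 + a l - a i)) (others r i))
                (W_arg q lq r s a b t * qpow lq ((of_nat s - of_nat r) * a i)))
         = qpoch_inf q (q powi t) * (\<Sum>k = - n_max r n..K_bound r s m n t. beta q lq r s a b m n t k)"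
proof -
  define A where "A = (\<lambda>i. qpow lq (a i))"
  define B where "B = (\<lambda>l. qpow lq (b l))"
  have q_nz: "q \<noteq> 0" using q by auto
  \<comment> \<open>\<open>A i / A l\<close> and \<open>A l / A i\<close> have nonvanishing infinite products, which excludes
      the nonpositive and the nonnegative powers of \<open>q\<close> as values of \<open>A i / A l\<close>\<close>
  have off: "off_q_lattice q (A i / A l)" if "i \<in> {1..r}" "l \<in> {1..r}" "l \<noteq> i" for i l
    unfolding off_q_lattice_def
  proof (intro allI notI)
    fix k :: int
    assume one: "A i / A l * q powi k = 1"
    have nz: "1 - A i / A l * q ^ p \<noteq> 0" "1 - A l / A i * q ^ p \<noteq> 0" for p
      using lhs_factor_nz[of i l] lhs_factor_nz[of l i] that qpoch_inf_eq_0[OF q(2), of _ p]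
      by (auto simp: qpow_diff A_def)
    show False
    proof (cases "k \<ge> 0")
      case True
      then show False using one nz(1)[of "nat k"] by (simp add: power_int_def)
    next
      case False
      then have "q powi k = 1 / q ^ nat (- k)" by (simp add: power_int_def divide_inverse power_inverse)
      then have "A l / A i * q ^ nat (- k) = 1"
      proof -
        have "A i / A l \<noteq> 0" by (simp add: A_def)
        with one have "q powi k = A l / A i" by (simp add: A_def field_simps)
        with \<open>q powi k = 1 / q ^ nat (- k)\<close> show ?thesis using q_nz by (simp add: field_simps)
      qed
      then show False using nz(2)[of "nat (- k)"] by simp
    qed
  qed
  have loc: "q_product_quotient q r s A B"
    by unfold_locales (use q q_nz rs off in \<open>auto simp: A_def B_def\<close>)
  interpret q_product_quotient q r s A B by (rule loc)
  let ?K = "K_bound r s m n t"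
  have e: "qpow lq (1 - b l + a i) = q * A i / B l" "qpow lq (b l - a i) = B l / A i"
    "qpow lq (a i - a l) = A i / A l" "qpow lq (1 + a l - a i) = q * A l / A i"
    "qpow lq (- b l) = 1 / B l" for i l
    by (simp_all add: qpow_add qpow_diff qpow_1 log_q A_def B_def)
       (simp add: qpow_def exp_minus divide_inverse)
  have e1: "qpow lq (a i * (1 - of_int t)) = A i powi (1 - t)" for i
    using qpow_mult_of_int[of lq "a i" "1 - t"] by (simp add: A_def)
  have e2: "qpow lq ((of_nat s - of_nat r) * a i) = A i powi (int s - int r)" for i
    using qpow_mult_of_int[of lq "a i" "int s - int r"] by (simp add: A_def mult.commute)
  have e3: "W_arg q lq r s a b t = q powi (t + int r - 1) * (\<Prod>l=1..r. A l) * (\<Prod>l=1..s. 1 / B l)"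
    unfolding W_arg_def e(5) by (simp add: A_def)
  have rhs: "qpoch_inf q (q powi t) * (\<Sum>k = - n_max r n..?K. beta q lq r s a b m n t k)
      = qpoch_inf q q * (if t \<le> 0 then 0 else fps_nth quotient_fps (nat t - 1))"
  proof (cases "t \<le> 0")
    case True
    have "qpoch_inf q (q powi t) = 0"
      by (rule qpoch_inf_eq_0[OF q(2), of _ "nat (- t)"])
         (use True q_nz in \<open>simp add: power_int_def field_simps\<close>)
    then show ?thesis using True by simp
  next
    case False
    define T where "T = nat t - 1"
    have t: "t = int (Suc T)" using False by (simp add: T_def)
    define \<gamma> where "\<gamma> j = (\<Sum>i=1..r. beta_term q lq r s a b m n t j i)" for j
    define c where "c u = fps_nth quotient_fps (T - u) * fps_nth (tail_fps m n) u" for u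
    \<comment> \<open>for \<open>j < - n_max r n\<close> there are no poles, and both sides are \<open>0\<close>\<close>
    have \<gamma>: "\<gamma> j = (\<Sum>u\<le>T. c u * (q powi j) ^ u)" if j: "?K - int T \<le> j" "j \<le> ?K" for j
    proof -
      define m_min where "m_min = Min (m ` {1..s})"
      have "?K - int T = (if s = 0 then p_bound r s m n t else max (- m_min - 1) (p_bound r s m n t)) + 1"
        unfolding K_bound_def m_min_def[symmetric] by (simp add: t)
      then have j_gt: "p_bound r s m n t < j" "s \<noteq> 0 \<Longrightarrow> - m_min \<le> j"
        using j(1) by (auto split: if_splits)
      have m: "0 \<le> m l + j" if "l \<in> {1..s}" for l
      proof -
        have "m_min \<le> m l" unfolding m_min_def using that by (intro Min_le) auto
        moreover have "s \<noteq> 0" using that by auto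
        ultimately show ?thesis using j_gt(2) by linarith
      qed
      have deg: "(\<Sum>l=1..s. m l) - (\<Sum>l=1..r. n l) - int r - t + 1 < (int r - int s) * j"
      proof -
        let ?x = "(\<Sum>l=1..s. m l) - (\<Sum>l=1..r. n l) - int r - t + 1"
        have "real_of_int ?x / (real r - real s) < real_of_int j"
          using j_gt(1) unfolding p_bound_def floor_less_iff .
        then have "real_of_int ?x < real_of_int ((int r - int s) * j)"
          using rs by (simp add: field_simps)
        then show ?thesis by (simp only: of_int_less_iff)
      qed
      have "\<gamma> j = (\<Sum>i=1..r. \<Sum>k<nat (j + n i + 1). pole_term m n t j i k)"
        unfolding \<gamma>_def
      proof (intro sum.cong refl)
        fix i assume i: "i \<in> {1..r}"
        have n_i: "n i \<le> n_max r n" unfolding n_max_def using i by (intro Max_ge) auto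
        show "beta_term q lq r s a b m n t j i = (\<Sum>k<nat (j + n i + 1). pole_term m n t j i k)"
          using beta_term_eq_sum_pole_terms[OF loc[unfolded A_def B_def] log_q i m]
            rhs_series_nz[OF i] n_i j(2)
          by (simp add: A_def B_def)
      qed
      then show ?thesis
        using False sum_pole_terms[of m j n t] m deg by (simp add: fps_mult_scale_nth c_def T_def)
    qed
    note conv = beta_eq_signed_qbinom_convolution[OF t \<gamma>_def]
    have "(\<Sum>k = - n_max r n..?K. beta q lq r s a b m n t k)
        = (\<Sum>k = - n_max r n..?K. \<Sum>d\<le>Suc T. signed_qbinom q (Suc T) d * \<gamma> (k - int d))"
      using rs by (intro sum.cong refl conv(2)) auto
    also have "\<dots> = (\<Sum>d\<le>T. q ^ d * signed_qbinom q T d * \<gamma> (?K - int d))"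
      using rs by (intro sum_signed_qbinom_convolution[OF q_nz q(2)] conv(1)) auto
    also have "\<dots> = (\<Sum>d\<le>T. \<Sum>u\<le>T. c u * (q powi ?K) ^ u * (signed_qbinom q T d * (q / q ^ u) ^ d))"
    proof (intro sum.cong refl)
      fix d assume d: "d \<in> {..T}"
      have "q ^ d * (q powi (?K - int d)) ^ u = (q powi ?K) ^ u * (q / q ^ u) ^ d" for u
        using q_nz by (simp add: power_int_diff power_divide mult.commute flip: power_mult)
      then show "q ^ d * signed_qbinom q T d * \<gamma> (?K - int d)
          = (\<Sum>u\<le>T. c u * (q powi ?K) ^ u * (signed_qbinom q T d * (q / q ^ u) ^ d))"
        using d by (subst \<gamma>) (auto simp: sum_distrib_left mult_ac intro!: sum.cong)
    qed
    also have "\<dots> = (\<Sum>u\<le>T. c u * (q powi ?K) ^ u * qpoch q (q / q ^ u) (int T))"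
      unfolding qpoch_eq_sum_signed_qbinom[OF q(2)] sum_distrib_left by (rule sum.swap)
    also have "\<dots> = (\<Sum>u\<in>{0}. c u * (q powi ?K) ^ u * qpoch q (q / q ^ u) (int T))"
      by (intro sum.mono_neutral_right) (auto simp: qpoch_negative_power_eq_0[OF q_nz])
    also have "\<dots> = fps_nth quotient_fps T * qpoch q q (int T)"
      by (simp add: c_def tail_fps_0)
    finally have "(\<Sum>k = - n_max r n..?K. beta q lq r s a b m n t k)
        = fps_nth quotient_fps T * qpoch q q (int T)" .
    moreover have "q powi t = q * q ^ T" unfolding t power_int_of_nat by simp
    moreover have "nat t - 1 = T" by (simp add: T_def)
    ultimately show ?thesis
      using False qpoch_inf_split[OF q(2), of q T] by (simp add: mult_ac)
  qed
  show ?thesis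
    unfolding rhs sum_qhyper_eq_coefficient[symmetric] e e1 e2 e3 by (simp only: mult.assoc)
qed

end
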